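(* Suppose that Condition A and Condition B hold and that $L(j)\ne0$ for all $j\in\{0,1,2,\dots\}$. Then the integral equation $$\int_0^tK(t,s)x(s)\,ds=f(t),\qquad 0<t\le T,$$ has in $\mathbb{C}_{[0,T]}$ a solution of the form $$x(t)=\sum_{i=0}^Nx_it^i+t^Nu(t),$$ where the constants $x_0,\dots,x_N$ are uniquely determined by the method of undetermined coefficients, i.e. by the requirement that $x^N(t)=\sum_{i=0}^Nx_it^i$ satisfies $\big(f(t)-\int_0^tK(t,s)x^N(s)\,ds\big)'=o(t^N)$ as $t\to+0$, and where $u\in\mathbb{C}_{[0,T]}$ is the uniquely determined continuous solution of $$\int_0^tK(t,s)s^Nu(s)\,ds=f(t)-\int_0^tK(t,s)x^N(s)\,ds,\qquad 0\le t\le T,$$ and is constructed by the successive approximations $u_{m+1}=Au_m+L_0^{-1}h$, which converge to $u$ in $\mathbb{C}_{[0,T]}$.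
   Context: Setting. Let $T>0$, $n\ge1$, and $0=\alpha_0<\alpha_1<\dots<\alpha_{n-1}<\alpha_n=1$. For $i=1,\dots,n$ let $K_i(t,s)$ be a real function on $\{0\le s\le t\le T\}$, continuous together with its partial derivative $K_i'(t,s)=\partial K_i(t,s)/\partial t$, and put $K(t,s)=K_i(t,s)$ for $\alpha_{i-1}t\le s<\alpha_i t$, $i=1,\dots,n$ (with $s=t$ included for $i=n$). Let $f\in\mathbb{C}^{(1)}_{[0,T]}$ be real valued with $f(0)=0$. Condition A. $K_n(t,t)\ne0$ for all $t\in[0,T]$, and the integer $N\ge0$ is such that, for some $q<1$, $$\max_{0\le t\le T}|K_n(t,t)|^{-1}\sum_{i=1}^n\Big(\alpha_i^{1+N}|K_i(t,\alpha_it)|+\alpha_{i-1}^{1+N}|K_i(t,\alpha_{i-1}t)|\Big)\le 1+q .$$ Condition B. With this $N$, the functions $K_i(t,s)$, $i=1,\dots,n$, and $f(t)$ are $N+1$ times differentiable in a neighborhood of zero (a neighborhood of $(0,0)$, respectively of $0$, within their domains). $L(j)=\sum_{i=1}^n K_i(0,0)(\alpha_i^{1+j}-\alpha_{i-1}^{1+j})$. $\mathbb{C}_{[0,T]}$ is the space of continuous real functions on $[0,T]$ with the maximum norm. Successive approximations. Define on $\mathbb{C}_{[0,T]}$ the operator $$(L_0u)(t)=\frac{1}{K_n(t,t)}\sum_{i=1}^n\Big(\alpha_i^{1+N}K_i(t,\alpha_it)u(\alpha_it)-\alpha_{i-1}^{1+N}K_i(t,\alpha_{i-1}t)u(\alpha_{i-1}t)\Big),$$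 which under Condition A has a bounded inverse, and $Au=-L_0^{-1}v$, where $v(t)=\sum_{i=1}^n\int_{\alpha_{i-1}t}^{\alpha_it}\frac{K_i'(t,s)}{K_n(t,t)}(s/t)^Nu(s)\,ds$ for $t>0$, $v(0)=0$. Given $x^N$, put $g(t)=f(t)-\int_0^tK(t,s)x^N(s)\,ds$ and $h(t)=t^{-N}g'(t)/K_n(t,t)$ for $t>0$, $h(0)=0$. The initial approximation $u_0\in\mathbb{C}_{[0,T]}$ is arbitrary. *)

theory Defs
  imports "HOL-Analysis.Analysis" "HOL-Library.Landau_Symbols"
begin

text \<open>The space of continuous real functions on \<open>[0,T]\<close> with the maximum norm. Its elements are
  taken to be extensional, so that equality in the space is equality of HOL functions.\<close>

definition C_space :: "real \<Rightarrow> (real \<Rightarrow> real) set" where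
  "C_space T = {u \<in> extensional {0..T}. continuous_on {0..T} u}"

definition max_norm :: "real \<Rightarrow> (real \<Rightarrow> real) \<Rightarrow> real" where
  "max_norm T u = (SUP t\<in>{0..T}. \<bar>u t\<bar>)"

definition kernel_domain :: "real \<Rightarrow> (real \<times> real) set" where
  "kernel_domain T = {(t, s). 0 \<le> s \<and> s \<le> t \<and> t \<le> T}"

text \<open>\<open>k\<close>-fold (Frechet) differentiability relative to \<open>S\<close>; the derivative of order \<open>k\<close> need not be
  continuous. A map into the linear maps on a finite-dimensional space is \<open>k\<close> times differentiable
  iff all its evaluations at fixed vectors are. The notion is only meaningful for sets on which
  derivatives are unique, such as intervals or relatively open parts of the triangle.\<close>

primrec times_differentiable_on ::
  "nat \<Rightarrow> ('a::euclidean_space \<Rightarrow> 'b::real_normed_vector) \<Rightarrow> 'a set \<Rightarrow> bool" where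
  "times_differentiable_on 0 f S \<longleftrightarrow> True"
| "times_differentiable_on (Suc k) f S \<longleftrightarrow>
     (\<exists>f'. (\<forall>x\<in>S. (f has_derivative f' x) (at x within S)) \<and>
           (\<forall>e. times_differentiable_on k (\<lambda>x. f' x e) S))"

text \<open>For \<open>0 < t\<close> the intervals \<open>[\<alpha>\<^sub>i\<^sub>-\<^sub>1 t, \<alpha>\<^sub>i t)\<close> partition \<open>[0,t)\<close>, so the index is unique.\<close>

definition kernel ::
  "nat \<Rightarrow> (nat \<Rightarrow> real) \<Rightarrow> (nat \<Rightarrow> real \<Rightarrow> real \<Rightarrow> real) \<Rightarrow> real \<Rightarrow> real \<Rightarrow> real" where
  "kernel n \<alpha> K t s =
     (if s = t then K n t s
      else K (THE i. i \<in> {1..n} \<and> \<alpha> (i - 1) * t \<le> s \<and> s < \<alpha> i * t) t s)"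

definition condition_A ::
  "real \<Rightarrow> nat \<Rightarrow> (nat \<Rightarrow> real) \<Rightarrow> (nat \<Rightarrow> real \<Rightarrow> real \<Rightarrow> real) \<Rightarrow> nat \<Rightarrow> bool" where
  "condition_A T n \<alpha> K N \<longleftrightarrow>
     (\<forall>t\<in>{0..T}. K n t t \<noteq> 0) \<and>
     (\<exists>q<1. (SUP t\<in>{0..T}. inverse \<bar>K n t t\<bar> *
        (\<Sum>i=1..n. \<alpha> i ^ (1 + N) * \<bar>K i t (\<alpha> i * t)\<bar>
                 + \<alpha> (i - 1) ^ (1 + N) * \<bar>K i t (\<alpha> (i - 1) * t)\<bar>)) \<le> 1 + q)"

definition condition_B ::
  "real \<Rightarrow> nat \<Rightarrow> (nat \<Rightarrow> real \<Rightarrow> real \<Rightarrow> real) \<Rightarrow> (real \<Rightarrow> real) \<Rightarrow> nat \<Rightarrow> bool" where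
  "condition_B T n K f N \<longleftrightarrow>
     (\<forall>i\<in>{1..n}. \<exists>U. open U \<and> (0, 0) \<in> U \<and>
        times_differentiable_on (N + 1) (\<lambda>(t, s). K i t s) (U \<inter> kernel_domain T)) \<and>
     (\<exists>U. open U \<and> 0 \<in> U \<and> times_differentiable_on (N + 1) f (U \<inter> {0..T}))"

definition char_L :: "nat \<Rightarrow> (nat \<Rightarrow> real) \<Rightarrow> (nat \<Rightarrow> real \<Rightarrow> real \<Rightarrow> real) \<Rightarrow> nat \<Rightarrow> real" where
  "char_L n \<alpha> K j = (\<Sum>i=1..n. K i 0 0 * (\<alpha> i ^ (1 + j) - \<alpha> (i - 1) ^ (1 + j)))"

definition op_L0 ::
  "real \<Rightarrow> nat \<Rightarrow> (nat \<Rightarrow> real) \<Rightarrow> (nat \<Rightarrow> real \<Rightarrow> real \<Rightarrow> real) \<Rightarrow> nat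
    \<Rightarrow> (real \<Rightarrow> real) \<Rightarrow> real \<Rightarrow> real" where
  "op_L0 T n \<alpha> K N u = (\<lambda>t\<in>{0..T}. 1 / K n t t *
     (\<Sum>i=1..n. \<alpha> i ^ (1 + N) * K i t (\<alpha> i * t) * u (\<alpha> i * t)
              - \<alpha> (i - 1) ^ (1 + N) * K i t (\<alpha> (i - 1) * t) * u (\<alpha> (i - 1) * t)))"

definition op_L0_inv ::
  "real \<Rightarrow> nat \<Rightarrow> (nat \<Rightarrow> real) \<Rightarrow> (nat \<Rightarrow> real \<Rightarrow> real \<Rightarrow> real) \<Rightarrow> nat
    \<Rightarrow> (real \<Rightarrow> real) \<Rightarrow> real \<Rightarrow> real" where
  "op_L0_inv T n \<alpha> K N = inv_into (C_space T) (op_L0 T n \<alpha> K N)"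

text \<open>Below, \<open>K'\<close> stands for the family of partial derivatives of \<open>K\<close> in the first argument.\<close>

definition op_V ::
  "real \<Rightarrow> nat \<Rightarrow> (nat \<Rightarrow> real) \<Rightarrow> (nat \<Rightarrow> real \<Rightarrow> real \<Rightarrow> real) \<Rightarrow> (nat \<Rightarrow> real \<Rightarrow> real \<Rightarrow> real)
    \<Rightarrow> nat \<Rightarrow> (real \<Rightarrow> real) \<Rightarrow> real \<Rightarrow> real" where
  "op_V T n \<alpha> K K' N u = (\<lambda>t\<in>{0..T}. if t = 0 then 0 else
     (\<Sum>i=1..n. integral {\<alpha> (i - 1) * t..\<alpha> i * t}
        (\<lambda>s. K' i t s / K n t t * (s / t) ^ N * u s)))"

definition op_A ::
  "real \<Rightarrow> nat \<Rightarrow> (nat \<Rightarrow> real) \<Rightarrow> (nat \<Rightarrow> real \<Rightarrow> real \<Rightarrow> real) \<Rightarrow> (nat \<Rightarrow> real \<Rightarrow> real \<Rightarrow> real)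
    \<Rightarrow> nat \<Rightarrow> (real \<Rightarrow> real) \<Rightarrow> real \<Rightarrow> real" where
  "op_A T n \<alpha> K K' N u = (\<lambda>t\<in>{0..T}. - op_L0_inv T n \<alpha> K N (op_V T n \<alpha> K K' N u) t)"

definition residual ::
  "nat \<Rightarrow> (nat \<Rightarrow> real) \<Rightarrow> (nat \<Rightarrow> real \<Rightarrow> real \<Rightarrow> real) \<Rightarrow> (real \<Rightarrow> real)
    \<Rightarrow> (real \<Rightarrow> real) \<Rightarrow> real \<Rightarrow> real" where
  "residual n \<alpha> K f y t = f t - integral {0..t} (\<lambda>s. kernel n \<alpha> K t s * y s)"

text \<open>The derivative of \<open>g\<close> on \<open>[0,T]\<close>, one-sided at the end points.\<close>

definition deriv_on :: "real \<Rightarrow> (real \<Rightarrow> real) \<Rightarrow> real \<Rightarrow> real" where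
  "deriv_on T g t = vector_derivative g (at t within {0..T})"

definition x_poly :: "nat \<Rightarrow> (nat \<Rightarrow> real) \<Rightarrow> real \<Rightarrow> real" where
  "x_poly N x t = (\<Sum>i\<le>N. x i * t ^ i)"

definition undetermined_coefficients ::
  "real \<Rightarrow> nat \<Rightarrow> (nat \<Rightarrow> real) \<Rightarrow> (nat \<Rightarrow> real \<Rightarrow> real \<Rightarrow> real) \<Rightarrow> (real \<Rightarrow> real) \<Rightarrow> nat
    \<Rightarrow> (nat \<Rightarrow> real) \<Rightarrow> bool" where
  "undetermined_coefficients T n \<alpha> K f N x \<longleftrightarrow>
     (\<forall>t\<in>{0<..T}. residual n \<alpha> K f (x_poly N x) differentiable (at t within {0..T})) \<and>
     deriv_on T (residual n \<alpha> K f (x_poly N x)) \<in> o[at_right 0](\<lambda>t. t ^ N)"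

definition rhs_h ::
  "real \<Rightarrow> nat \<Rightarrow> (nat \<Rightarrow> real) \<Rightarrow> (nat \<Rightarrow> real \<Rightarrow> real \<Rightarrow> real) \<Rightarrow> (real \<Rightarrow> real) \<Rightarrow> nat
    \<Rightarrow> (nat \<Rightarrow> real) \<Rightarrow> real \<Rightarrow> real" where
  "rhs_h T n \<alpha> K f N x = (\<lambda>t\<in>{0..T}. if t = 0 then 0 else
     inverse (t ^ N) * deriv_on T (residual n \<alpha> K f (x_poly N x)) t / K n t t)"

definition solves_equation ::
  "real \<Rightarrow> nat \<Rightarrow> (nat \<Rightarrow> real) \<Rightarrow> (nat \<Rightarrow> real \<Rightarrow> real \<Rightarrow> real) \<Rightarrow> (real \<Rightarrow> real)
    \<Rightarrow> (real \<Rightarrow> real) \<Rightarrow> bool" where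
  "solves_equation T n \<alpha> K f y \<longleftrightarrow>
     (\<forall>t\<in>{0<..T}. ((\<lambda>s. kernel n \<alpha> K t s * y s) has_integral f t) {0..t})"

definition solves_reduced_equation ::
  "real \<Rightarrow> nat \<Rightarrow> (nat \<Rightarrow> real) \<Rightarrow> (nat \<Rightarrow> real \<Rightarrow> real \<Rightarrow> real) \<Rightarrow> (real \<Rightarrow> real) \<Rightarrow> nat
    \<Rightarrow> (nat \<Rightarrow> real) \<Rightarrow> (real \<Rightarrow> real) \<Rightarrow> bool" where
  "solves_reduced_equation T n \<alpha> K f N x u \<longleftrightarrow>
     (\<forall>t\<in>{0..T}. ((\<lambda>s. kernel n \<alpha> K t s * (s ^ N * u s)) has_integral
        residual n \<alpha> K f (x_poly N x) t) {0..t})"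

end

theory Submission
  imports Defs
begin

text \<open>
  Differentiating the equation turns this Volterra equation of the first kind into a functional
  equation. For every \<open>m\<close> and continuous \<open>u\<close>, the function \<open>t \<mapsto> \<integral>\<^sub>0\<^sup>t K(t,s) s\<^sup>m u(s) ds\<close> has on
  \<open>[0,T]\<close> a derivative of the form \<open>t\<^sup>m\<close> times a continuous function, which consists of a part from the
  moving end points of the pieces of \<open>K\<close> and an integral part (\<open>kernel_integral_deriv\<close>). The
  theorem follows from two uses of this formula.

  With \<open>u = 1\<close> it describes the derivative of the residual of a polynomial. The continuous
  factor belonging to \<open>s\<^sup>m\<close> has the value \<open>L(m)\<close> at 0, and by Condition B it has a Taylor polynomial of
  order \<open>N\<close> there. The requirement that the derivative of the residual is \<open>o(t\<^sup>N)\<close> is therefore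
  a triangular linear system with the diagonal \<open>L(0), \<dots>, L(N)\<close>, so that it determines
  the coefficients uniquely (\<open>triangular_coefficients_exist\<close>, \<open>triangular_coefficients_unique\<close>).
  Taylor polynomials are needed for the kernels along all rays from the origin simultaneously, and
  without continuity of the highest derivative; this is \<open>taylor_along_rays\<close>.

  With \<open>m = N\<close> it shows that the reduced equation for \<open>u\<close> is equivalent to \<open>L\<^sub>0 u + V u = h\<close>, where
  \<open>V\<close> is a Volterra operator and \<open>h\<close> is continuous precisely by the choice of the coefficients
  (\<open>h_mem\<close>, \<open>reduced_iff\<close>). By Condition A, \<open>L\<^sub>0\<close> differs from the identity by an operator
  of norm at most \<open>q < 1\<close>. Its value at \<open>t\<close> only involves \<open>u\<close> at arguments up to \<open>t\<close>, so the bound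
  also holds in every norm \<open>sup \<bar>u(t)\<bar> exp (- \<kappa> t)\<close> with \<open>\<kappa> \<ge> 0\<close>; hence \<open>L\<^sub>0\<close> has an inverse bounded
  independently of \<open>\<kappa>\<close> (\<open>L0_coercive\<close>, \<open>L0_bij\<close>). In the same norm \<open>V\<close> has a bound proportional to
  \<open>1 / \<kappa>\<close> (\<open>V_bound\<close>). For large \<open>\<kappa>\<close> the successive approximations thus are the orbit of a contraction
  (\<open>successive_approximations\<close>).
\<close>

section \<open>Taylor expansion along rays\<close>

lemma times_differentiable_on_SucD:
  "times_differentiable_on (Suc k) f S \<Longrightarrow> times_differentiable_on k f S"
proof (induction k arbitrary: f)
  case (Suc k)
  then show ?case
    by (metis times_differentiable_on.simps(2))
qed simp

text \<open>A Peano form of Taylor's theorem, uniform over a bounded set of directions, for functions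
  whose highest derivatives need not be continuous or even bounded. The coefficients are found by
  induction on the order: expand the partial derivatives, and integrate the resulting polynomial
  along each ray. The remainder is then controlled by the mean value theorem, which only needs
  pointwise differentiability. The step from order 0 to order 1 is separate, since a first
  derivative existing near the origin need not be continuous there; it uses the definition of
  the derivative at the origin instead.\<close>
lemma taylor_along_rays:
  fixes h :: "'a::euclidean_space \<Rightarrow> real"
  assumes "times_differentiable_on N h S" and "continuous (at 0 within S) h"
    and V: "bounded V" and \<delta>: "\<delta> > 0"
    and ray: "\<And>v t. v \<in> V \<Longrightarrow> t \<in> {0..\<delta>} \<Longrightarrow> t *\<^sub>R v \<in> S"
  shows "\<exists>c. (\<forall>j. continuous_on V (c j)) \<and>
    (\<forall>\<epsilon>>0. \<exists>\<eta>>0. \<forall>t\<in>{0..\<eta>}. \<forall>v\<in>V. \<bar>h (t *\<^sub>R v) - (\<Sum>j\<le>N. c j v * t ^ j)\<bar> \<le> \<epsilon> * t ^ N)"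
proof (cases "V = {}")
  case True
  then show ?thesis by (auto intro!: exI[of _ "\<lambda>_ _. 0"] exI[of _ "1::real"])
next
  case False
  then have S0: "0 \<in> S" using ray[of _ 0] \<delta> by auto
  obtain B where B: "B > 0" "\<And>v. v \<in> V \<Longrightarrow> norm v \<le> B"
    using V bounded_pos by blast
  show ?thesis using assms(1,2)
  proof (induction N arbitrary: h)
    case 0
    have "\<exists>\<eta>>0. \<forall>t\<in>{0..\<eta>}. \<forall>v\<in>V. \<bar>h (t *\<^sub>R v) - h 0\<bar> \<le> \<epsilon>" if \<epsilon>: "\<epsilon> > 0" for \<epsilon>
    proof -
      obtain d where d: "d > 0" "\<And>x. x \<in> S \<Longrightarrow> dist x 0 < d \<Longrightarrow> dist (h x) (h 0) < \<epsilon>"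
        using 0(2) \<epsilon> unfolding continuous_within_eps_delta by (metis)
      show ?thesis
      proof (intro exI conjI ballI)
        show "min \<delta> (d / (2 * B)) > 0" using \<delta> d B by simp
        fix t v assume t: "t \<in> {0..min \<delta> (d / (2 * B))}" and v: "v \<in> V"
        have "norm (t *\<^sub>R v) = t * norm v" using t by simp
        also have "\<dots> \<le> d / (2 * B) * B"
          using t B d B(2)[OF v] by (intro mult_mono) auto
        also have "\<dots> < d" using B d by simp
        finally show "\<bar>h (t *\<^sub>R v) - h 0\<bar> \<le> \<epsilon>"
          using d(2)[of "t *\<^sub>R v"] ray[OF v, of t] t by (auto simp: dist_real_def)
      qed
    qed
    then show ?case by (intro exI[of _ "\<lambda>_ _. h 0"]) auto
  next
    case (Suc N)
    obtain h' where h': "\<And>x. x \<in> S \<Longrightarrow> (h has_derivative h' x) (at x within S)"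
      and td: "\<And>e. times_differentiable_on N (\<lambda>x. h' x e) S"
      using Suc.prems(1) by auto
    show ?case
    proof (cases N)
      case N: 0
      let ?c = "\<lambda>j v. if j = 0 then h 0 else h' 0 v"
      interpret bounded_linear "h' 0" using h'[OF S0] by (rule has_derivative_bounded_linear)
      have "\<exists>\<eta>>0. \<forall>t\<in>{0..\<eta>}. \<forall>v\<in>V.
          \<bar>h (t *\<^sub>R v) - (\<Sum>j\<le>Suc N. ?c j v * t ^ j)\<bar> \<le> \<epsilon> * t ^ Suc N" if \<epsilon>: "\<epsilon> > 0" for \<epsilon>
      proof -
        obtain d where d: "d > 0"
          "\<And>x. x \<in> S \<Longrightarrow> norm x < d \<Longrightarrow> norm (h x - h 0 - h' 0 x) \<le> \<epsilon> / B * norm x"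
          using h'[OF S0] \<epsilon> B unfolding has_derivative_within_alt
          by (metis diff_zero divide_pos_pos)
        show ?thesis
        proof (intro exI conjI ballI)
          show "min \<delta> (d / (2 * B)) > 0" using \<delta> d B by simp
          fix t v assume t: "t \<in> {0..min \<delta> (d / (2 * B))}" and v: "v \<in> V"
          have "norm (t *\<^sub>R v) = t * norm v" using t by simp
        also have "\<dots> \<le> d / (2 * B) * B"
            using t B d B(2)[OF v] by (intro mult_mono) auto
          also have "\<dots> < d" using B d by simp
          finally have "norm (h (t *\<^sub>R v) - h 0 - h' 0 (t *\<^sub>R v)) \<le> \<epsilon> / B * norm (t *\<^sub>R v)"
            using d(2)[of "t *\<^sub>R v"] ray[OF v, of t] t by auto
          also have "\<dots> \<le> \<epsilon> / B * (t * B)"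
            using t B(2)[OF v] \<epsilon> B by (intro mult_left_mono) (auto intro: mult_left_mono)
          finally show "\<bar>h (t *\<^sub>R v) - (\<Sum>j\<le>Suc N. ?c j v * t ^ j)\<bar> \<le> \<epsilon> * t ^ Suc N"
            using B by (simp add: N scaleR mult.commute diff_diff_eq)
        qed
      qed
      moreover have "continuous_on V (?c j)" for j :: nat
        by (cases j) (auto intro: continuous_on continuous_on_id)
      ultimately show ?thesis by (intro exI[of _ ?c]) blast
    next
      case N: (Suc M)
      have "continuous (at 0 within S) (\<lambda>x. h' x e)" for e
        using td[of e] S0 unfolding N by (auto intro: has_derivative_continuous)
      then have "\<exists>c. (\<forall>j. continuous_on V (c j)) \<and> (\<forall>\<epsilon>>0. \<exists>\<eta>>0. \<forall>t\<in>{0..\<eta>}. \<forall>v\<in>V.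
          \<bar>h' (t *\<^sub>R v) e - (\<Sum>j\<le>N. c j v * t ^ j)\<bar> \<le> \<epsilon> * t ^ N)" for e
        using Suc.IH[OF td] by blast
      then obtain c where c: "\<And>e j. continuous_on V (c e j)"
        "\<And>e \<epsilon>. \<epsilon> > 0 \<Longrightarrow> \<exists>\<eta>>0. \<forall>t\<in>{0..\<eta>}. \<forall>v\<in>V.
          \<bar>h' (t *\<^sub>R v) e - (\<Sum>j\<le>N. c e j v * t ^ j)\<bar> \<le> \<epsilon> * t ^ N"
        by metis
      \<comment> \<open>The directional derivative along \<open>v\<close> has the coefficients
        \<open>\<Sum>\<^sub>e (v \<bullet> e) c\<^sub>e\<^sub>,\<^sub>i\<close>; integrating \<open>t\<^sup>i\<close> divides the \<open>i\<close>-th one by \<open>i + 1\<close>.\<close>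
      define C where "C j v = (case j of 0 \<Rightarrow> h 0
        | Suc i \<Rightarrow> (\<Sum>e\<in>Basis. (v \<bullet> e) * c e i v) / (real i + 1))" for j v
      have "continuous_on V (C j)" for j
        unfolding C_def by (cases j) (auto intro!: continuous_intros c)
      moreover have "\<exists>\<eta>>0. \<forall>t\<in>{0..\<eta>}. \<forall>v\<in>V.
          \<bar>h (t *\<^sub>R v) - (\<Sum>j\<le>Suc N. C j v * t ^ j)\<bar> \<le> \<epsilon> * t ^ Suc N" if \<epsilon>: "\<epsilon> > 0" for \<epsilon>
      proof -
        define \<epsilon>' where "\<epsilon>' = \<epsilon> / (B * DIM('a))"
        have \<epsilon>': "\<epsilon>' > 0" using \<epsilon> B by (simp add: \<epsilon>'_def)
        obtain \<eta> where \<eta>: "\<And>e. \<eta> e > 0" "\<And>e t v. t \<in> {0..\<eta> e} \<Longrightarrow> v \<in> V \<Longrightarrow>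
            \<bar>h' (t *\<^sub>R v) e - (\<Sum>j\<le>N. c e j v * t ^ j)\<bar> \<le> \<epsilon>' * t ^ N"
          using c(2)[OF \<epsilon>'] by metis
        define \<eta>' where "\<eta>' = Min (insert \<delta> (\<eta> ` Basis))"
        have \<eta>': "\<eta>' > 0" "\<eta>' \<le> \<delta>" "\<And>e. e \<in> Basis \<Longrightarrow> \<eta>' \<le> \<eta> e"
          using \<delta> \<eta>(1) unfolding \<eta>'_def by (simp, simp, intro Min_le, auto)
        show ?thesis
        proof (intro exI conjI ballI)
          show "\<eta>' > 0" by fact
          fix t v assume t: "t \<in> {0..\<eta>'}" and v: "v \<in> V"
          let ?\<phi> = "\<lambda>r. h (r *\<^sub>R v) - (\<Sum>j\<le>Suc N. C j v * r ^ j)"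
          let ?\<phi>' = "\<lambda>r. \<Sum>e\<in>Basis. (v \<bullet> e) * (h' (r *\<^sub>R v) e - (\<Sum>j\<le>N. c e j v * r ^ j))"
          have D: "(?\<phi> has_real_derivative ?\<phi>' r) (at r within {0..t})" if r: "r \<in> {0..t}" for r
          proof -
            have rS: "r *\<^sub>R v \<in> S" using ray[OF v, of r] r t \<eta>' by auto
            interpret bounded_linear "h' (r *\<^sub>R v)"
              using h'[OF rS] by (rule has_derivative_bounded_linear)
            have 1: "h' (r *\<^sub>R v) v = (\<Sum>e\<in>Basis. (v \<bullet> e) * h' (r *\<^sub>R v) e)"
              by (subst euclidean_representation[of v, symmetric]) (simp add: sum scaleR)
            have "((\<lambda>r. h (r *\<^sub>R v)) has_derivative (\<lambda>s. h' (r *\<^sub>R v) (s *\<^sub>R v))) (at r within {0..t})"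
            proof (rule has_derivative_in_compose[where f = "\<lambda>r. r *\<^sub>R v"])
              show "((\<lambda>r. r *\<^sub>R v) has_derivative (\<lambda>s. s *\<^sub>R v)) (at r within {0..t})"
                by (auto intro!: derivative_eq_intros)
              show "(h has_derivative h' (r *\<^sub>R v)) (at (r *\<^sub>R v) within (\<lambda>r. r *\<^sub>R v) ` {0..t})"
                using ray[OF v] t \<eta>' by (intro has_derivative_subset[OF h'[OF rS]]) auto
            qed
            then have 2: "((\<lambda>r. h (r *\<^sub>R v)) has_real_derivative h' (r *\<^sub>R v) v) (at r within {0..t})"
              unfolding has_field_derivative_def by (simp add: scaleR mult.commute[of _ "h' (r *\<^sub>R v) v"])
            have "((\<lambda>r. C 0 v + (\<Sum>j\<le>N. C (Suc j) v * r ^ Suc j)) has_real_derivative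
               (\<Sum>j\<le>N. C (Suc j) v * (real (Suc j) * r ^ j))) (at r within {0..t})"
              by (auto intro!: derivative_eq_intros sum.cong simp del: power_Suc simp: mult_ac)
            also have "(\<lambda>r. C 0 v + (\<Sum>j\<le>N. C (Suc j) v * r ^ Suc j)) = (\<lambda>r. \<Sum>j\<le>Suc N. C j v * r ^ j)"
              by (subst sum.atMost_Suc_shift) simp
            also have "(\<Sum>j\<le>N. C (Suc j) v * (real (Suc j) * r ^ j))
                = (\<Sum>j\<le>N. \<Sum>e\<in>Basis. (v \<bullet> e) * (c e j v * r ^ j))"
            proof (intro sum.cong refl)
              fix j
              have *: "X / (real j + 1) * (real (Suc j) * Y) = X * Y" for X Y
                by (simp add: field_simps)
              show "C (Suc j) v * (real (Suc j) * r ^ j) = (\<Sum>e\<in>Basis. (v \<bullet> e) * (c e j v * r ^ j))"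
                unfolding C_def nat.case * by (simp add: sum_distrib_right mult.assoc)
            qed
            also have "\<dots> = (\<Sum>e\<in>Basis. (v \<bullet> e) * (\<Sum>j\<le>N. c e j v * r ^ j))"
              by (subst sum.swap) (simp add: sum_distrib_left)
            finally have 3: "((\<lambda>r. \<Sum>j\<le>Suc N. C j v * r ^ j) has_real_derivative
               (\<Sum>e\<in>Basis. (v \<bullet> e) * (\<Sum>j\<le>N. c e j v * r ^ j))) (at r within {0..t})" .
            show ?thesis using DERIV_diff[OF 2 3] unfolding 1
              by (simp add: right_diff_distrib sum_subtractf)
          qed
          have bd: "norm (?\<phi>' r) \<le> \<epsilon> * t ^ N" if r: "r \<in> {0..t}" for r
          proof -
            have "norm (?\<phi>' r) \<le> (\<Sum>e\<in>(Basis :: 'a set). B * (\<epsilon>' * t ^ N))"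
            proof (rule sum_norm_le)
              fix e :: 'a assume e: "e \<in> Basis"
              have "\<bar>v \<bullet> e\<bar> \<le> B" using Basis_le_norm[OF e, of v] B(2)[OF v] by simp
              moreover have "\<bar>h' (r *\<^sub>R v) e - (\<Sum>j\<le>N. c e j v * r ^ j)\<bar> \<le> \<epsilon>' * r ^ N"
                using \<eta>(2)[OF _ v, of r e] r t \<eta>'(3)[OF e] by auto
              moreover have "\<epsilon>' * r ^ N \<le> \<epsilon>' * t ^ N"
                using r \<epsilon>' by (auto intro!: mult_left_mono power_mono)
              ultimately show "norm ((v \<bullet> e) * (h' (r *\<^sub>R v) e - (\<Sum>j\<le>N. c e j v * r ^ j)))
                  \<le> B * (\<epsilon>' * t ^ N)"
                using B by (auto simp: abs_mult intro!: mult_mono)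
            qed
            then show ?thesis using B by (simp add: \<epsilon>'_def)
          qed
          have "norm (?\<phi> t - ?\<phi> 0) \<le> \<epsilon> * t ^ N * norm (t - 0)"
            using t by (intro field_differentiable_bound[OF _ D bd]) auto
          moreover have "(\<Sum>j\<le>Suc N. C j v * 0 ^ j) = h 0"
            by (subst sum.atMost_Suc_shift) (simp add: C_def)
          ultimately show "\<bar>?\<phi> t\<bar> \<le> \<epsilon> * t ^ Suc N"
            using t by (simp add: mult_ac)
        qed
      qed
      ultimately show ?thesis by blast
    qed
  qed
qed

section \<open>Taylor polynomials at the left end point\<close>

lemma power_smallo_at_right_0:
  "m > N \<Longrightarrow> (\<lambda>t::real. t ^ m) \<in> o[at_right 0](\<lambda>t. t ^ N)"
proof (rule smalloI_tendsto)
  assume "m > N"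
  then have "((\<lambda>t::real. t ^ (m - N)) \<longlongrightarrow> 0 ^ (m - N)) (at_right 0)"
    by (intro tendsto_intros)
  then have "((\<lambda>t::real. t ^ (m - N)) \<longlongrightarrow> 0) (at_right 0)"
    using \<open>m > N\<close> by (simp add: power_0_left)
  then show "((\<lambda>t::real. t ^ m / t ^ N) \<longlongrightarrow> 0) (at_right 0)"
    by (rule Lim_transform_eventually)
       (use \<open>m > N\<close> in \<open>auto simp: eventually_at_filter power_diff intro!: always_eventually\<close>)
next
  show "\<forall>\<^sub>F t in at_right 0. (t::real) ^ N \<noteq> 0"
    unfolding eventually_at_filter by (rule always_eventually) auto
qed

text \<open>A factor with a limit at 0 does not disturb a remainder term.\<close>
lemma bounded_smallo_at_right_0:
  assumes "(\<psi> \<longlongrightarrow> (L::real)) (at_right 0)" and "g \<in> o[at_right 0](\<lambda>t. t ^ N)"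
  shows "(\<lambda>t. \<psi> t * g t) \<in> o[at_right 0](\<lambda>t. t ^ N)"
proof -
  have "\<psi> \<in> O[at_right 0](\<lambda>_. 1)" using assms(1) by (intro bigoI_tendsto[where c = L]) auto
  from landau_o.big_small_mult[OF this assms(2)] show ?thesis by simp
qed

text \<open>Only the existence of an approximating polynomial matters, so no degree bound is imposed; this
  makes the notion trivially stable under multiplication by polynomials.\<close>

abbreviation taylor_approx :: "nat \<Rightarrow> (real \<Rightarrow> real) \<Rightarrow> bool" where
  "taylor_approx N \<phi> \<equiv> \<exists>p. (\<lambda>t. \<phi> t - poly p t) \<in> o[at_right 0](\<lambda>t. t ^ N)"

lemma taylor_approx_add:
  assumes "taylor_approx N \<phi>" "taylor_approx N \<eta>"
  shows "taylor_approx N (\<lambda>t. \<phi> t + \<eta> t)"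
proof -
  obtain p q where "(\<lambda>t. \<phi> t - poly p t) \<in> o[at_right 0](\<lambda>t. t ^ N)" "(\<lambda>t. \<eta> t - poly q t) \<in> o[at_right 0](\<lambda>t. t ^ N)"
    using assms by blast
  from sum_in_smallo(1)[OF this] show ?thesis
    by (intro exI[of _ "p + q"]) (simp add: algebra_simps)
qed

lemma taylor_approx_poly_mult:
  assumes "taylor_approx N \<phi>"
  shows "taylor_approx N (\<lambda>t. poly r t * \<phi> t)"
proof -
  obtain p where p: "(\<lambda>t. \<phi> t - poly p t) \<in> o[at_right 0](\<lambda>t. t ^ N)" using assms by blast
  have "(poly r \<longlongrightarrow> poly r 0) (at_right 0)" by (intro tendsto_intros)
  from bounded_smallo_at_right_0[OF this p] show ?thesis
    by (intro exI[of _ "r * p"]) (simp add: algebra_simps)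
qed

lemma taylor_approx_sum:
  assumes "finite A" "\<And>i. i \<in> A \<Longrightarrow> taylor_approx N (\<phi> i)"
  shows "taylor_approx N (\<lambda>t. \<Sum>i\<in>A. \<phi> i t)"
  using assms
proof (induction A rule: finite_induct)
  case empty
  show ?case by (intro exI[of _ 0]) simp
next
  case (insert i A)
  then show ?case using taylor_approx_add[of "\<phi> i" N "\<lambda>t. \<Sum>i\<in>A. \<phi> i t"] by simp
qed

lemma taylor_approxI:
  assumes "\<And>\<epsilon>. \<epsilon> > 0 \<Longrightarrow> \<exists>\<eta>>0. \<forall>t\<in>{0..\<eta>}. \<bar>\<phi> t - (\<Sum>j\<le>N. c j * t ^ j)\<bar> \<le> \<epsilon> * t ^ N"
  shows "taylor_approx N \<phi>"
proof (intro exI landau_o.smallI)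
  fix \<epsilon> :: real assume "\<epsilon> > 0"
  from assms[OF this] obtain \<eta> where \<eta>: "\<eta> > 0"
    "\<And>t. t \<in> {0..\<eta>} \<Longrightarrow> \<bar>\<phi> t - (\<Sum>j\<le>N. c j * t ^ j)\<bar> \<le> \<epsilon> * t ^ N" by blast
  show "\<forall>\<^sub>F t in at_right 0. norm (\<phi> t - poly (\<Sum>j\<le>N. monom (c j) j) t) \<le> \<epsilon> * norm (t ^ N)"
    unfolding eventually_at_right_field
  proof (intro exI conjI allI impI)
    show "\<eta> > 0" by fact
    fix t assume "t > 0" "t < \<eta>"
    then show "norm (\<phi> t - poly (\<Sum>j\<le>N. monom (c j) j) t) \<le> \<epsilon> * norm (t ^ N)"
      using \<eta>(2)[of t] by (simp add: poly_sum poly_monom)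
  qed
qed

text \<open>An order \<open>N\<close> expansion of \<open>k t (\<sigma> t)\<close> in \<open>t\<close>, uniformly in \<open>\<sigma>\<close>. Uniformity and the continuity of
  the coefficients allow it to be integrated over \<open>\<sigma>\<close>.\<close>

definition ray_expandable :: "nat \<Rightarrow> (real \<Rightarrow> real \<Rightarrow> real) \<Rightarrow> bool" where
  "ray_expandable N k \<longleftrightarrow> (\<exists>c. (\<forall>j. continuous_on {0..1} (c j)) \<and>
    (\<forall>\<epsilon>>0. \<exists>\<eta>>0. \<forall>t\<in>{0..\<eta>}. \<forall>\<sigma>\<in>{0..1}. \<bar>k t (\<sigma> * t) - (\<Sum>j\<le>N. c j \<sigma> * t ^ j)\<bar> \<le> \<epsilon> * t ^ N))"

lemma ray_expandable_fixed:
  assumes "ray_expandable N k" "\<sigma> \<in> {0..1}"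
  shows "taylor_approx N (\<lambda>t. k t (\<sigma> * t))"
proof -
  obtain c where "\<And>\<epsilon>. \<epsilon> > 0 \<Longrightarrow> \<exists>\<eta>>0. \<forall>t\<in>{0..\<eta>}. \<forall>\<sigma>\<in>{0..1}. \<bar>k t (\<sigma> * t) - (\<Sum>j\<le>N. c j \<sigma> * t ^ j)\<bar> \<le> \<epsilon> * t ^ N"
    using assms(1) unfolding ray_expandable_def by blast
  then show ?thesis using assms(2) by (intro taylor_approxI[where c = "\<lambda>j. c j \<sigma>"]) blast
qed

lemma ray_expandable_integral:
  assumes "ray_expandable N k" "0 \<le> a" "a \<le> b" "b \<le> 1" "T > 0"
    and int: "\<And>t. t \<in> {0..T} \<Longrightarrow> (\<lambda>\<sigma>. k t (\<sigma> * t) * \<sigma> ^ m) integrable_on {a..b}"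
  shows "taylor_approx N (\<lambda>t. integral {a..b} (\<lambda>\<sigma>. k t (\<sigma> * t) * \<sigma> ^ m))"
proof -
  obtain c where c: "\<And>j. continuous_on {0..1} (c j)" and
    ex: "\<And>\<epsilon>. \<epsilon> > 0 \<Longrightarrow> \<exists>\<eta>>0. \<forall>t\<in>{0..\<eta>}. \<forall>\<sigma>\<in>{0..1}. \<bar>k t (\<sigma> * t) - (\<Sum>j\<le>N. c j \<sigma> * t ^ j)\<bar> \<le> \<epsilon> * t ^ N"
    using assms(1) unfolding ray_expandable_def by blast
  have ab: "{a..b} \<subseteq> {0..1}" using assms by auto
  have c_int: "(\<lambda>\<sigma>. c j \<sigma> * \<sigma> ^ m) integrable_on {a..b}" for j
    using ab by (intro integrable_continuous_interval continuous_intros continuous_on_subset[OF c])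
  show ?thesis
  proof (rule taylor_approxI[where c = "\<lambda>j. integral {a..b} (\<lambda>\<sigma>. c j \<sigma> * \<sigma> ^ m)"])
    fix \<epsilon> :: real assume \<epsilon>: "\<epsilon> > 0"
    from ex[OF this] obtain \<eta> where \<eta>: "\<eta> > 0"
      "\<And>t \<sigma>. t \<in> {0..\<eta>} \<Longrightarrow> \<sigma> \<in> {0..1} \<Longrightarrow> \<bar>k t (\<sigma> * t) - (\<Sum>j\<le>N. c j \<sigma> * t ^ j)\<bar> \<le> \<epsilon> * t ^ N"
      by blast
    show "\<exists>\<eta>>0. \<forall>t\<in>{0..\<eta>}. \<bar>integral {a..b} (\<lambda>\<sigma>. k t (\<sigma> * t) * \<sigma> ^ m)
        - (\<Sum>j\<le>N. integral {a..b} (\<lambda>\<sigma>. c j \<sigma> * \<sigma> ^ m) * t ^ j)\<bar> \<le> \<epsilon> * t ^ N"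
    proof (intro exI conjI ballI)
      show "min \<eta> T > 0" using \<eta> \<open>T > 0\<close> by simp
      fix t assume "t \<in> {0..min \<eta> T}"
      then have t: "t \<in> {0..\<eta>}" "t \<in> {0..T}" by auto
      let ?c = "\<lambda>\<sigma>. \<Sum>j\<le>N. c j \<sigma> * \<sigma> ^ m * t ^ j"
      have sum_int: "?c integrable_on {a..b}"
        by (intro integrable_sum integrable_on_mult_left c_int) simp
      have "(\<Sum>j\<le>N. integral {a..b} (\<lambda>\<sigma>. c j \<sigma> * \<sigma> ^ m) * t ^ j) = integral {a..b} ?c"
        by (subst integral_sum) (auto intro!: integrable_on_mult_left c_int)
      then have "integral {a..b} (\<lambda>\<sigma>. k t (\<sigma> * t) * \<sigma> ^ m) - (\<Sum>j\<le>N. integral {a..b} (\<lambda>\<sigma>. c j \<sigma> * \<sigma> ^ m) * t ^ j)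
          = integral {a..b} (\<lambda>\<sigma>. k t (\<sigma> * t) * \<sigma> ^ m - ?c \<sigma>)"
        using integral_diff[OF int[OF t(2)] sum_int] by simp
      also have "norm \<dots> \<le> integral {a..b} (\<lambda>\<sigma>. \<epsilon> * t ^ N)"
      proof (rule integral_norm_bound_integral)
        show "(\<lambda>\<sigma>. k t (\<sigma> * t) * \<sigma> ^ m - ?c \<sigma>) integrable_on {a..b}"
          by (intro integrable_diff int t sum_int)
        show "(\<lambda>\<sigma>. \<epsilon> * t ^ N) integrable_on {a..b}" by (rule integrable_const_ivl)
        fix \<sigma> assume "\<sigma> \<in> {a..b}"
        then have \<sigma>: "\<sigma> \<in> {0..1}" using ab by blast
        have "k t (\<sigma> * t) * \<sigma> ^ m - ?c \<sigma> = (k t (\<sigma> * t) - (\<Sum>j\<le>N. c j \<sigma> * t ^ j)) * \<sigma> ^ m"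
          unfolding left_diff_distrib sum_distrib_right by (simp add: mult_ac)
        also have "norm \<dots> = \<bar>k t (\<sigma> * t) - (\<Sum>j\<le>N. c j \<sigma> * t ^ j)\<bar> * \<sigma> ^ m"
          using \<sigma> by (simp add: abs_mult)
        also have "\<dots> \<le> \<epsilon> * t ^ N * 1"
          using \<sigma> \<eta>(2)[OF t(1) \<sigma>] \<epsilon> t by (intro mult_mono power_le_one) auto
        finally show "norm (k t (\<sigma> * t) * \<sigma> ^ m - ?c \<sigma>) \<le> \<epsilon> * t ^ N" by simp
      qed
      also have "\<dots> = (b - a) * (\<epsilon> * t ^ N)" using assms by simp
      also have "\<dots> \<le> 1 * (\<epsilon> * t ^ N)" using assms \<epsilon> t by (intro mult_right_mono) auto
      finally show "\<bar>integral {a..b} (\<lambda>\<sigma>. k t (\<sigma> * t) * \<sigma> ^ m)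
          - (\<Sum>j\<le>N. integral {a..b} (\<lambda>\<sigma>. c j \<sigma> * \<sigma> ^ m) * t ^ j)\<bar> \<le> \<epsilon> * t ^ N" by simp
    qed
  qed
qed

text \<open>The kernel is allowed to agree with the differentiable function \<open>h\<close> only for \<open>t < T\<close>: at the
  corner \<open>(T, T)\<close> the \<open>t\<close>-derivative of a kernel is a derivative over a single point and hence
  is not determined by the kernel.\<close>

lemma ray_expandable_times_differentiable:
  fixes h :: "real \<times> real \<Rightarrow> real"
  assumes T: "T > 0" and U: "open U" "(0, 0) \<in> U"
    and td: "times_differentiable_on N h (U \<inter> kernel_domain T)"
    and cont: "continuous (at 0 within U \<inter> kernel_domain T) h"
    and eq: "\<And>t s. (t, s) \<in> U \<inter> kernel_domain T \<Longrightarrow> t < T \<Longrightarrow> h (t, s) = k t s"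
  shows "ray_expandable N k"
proof -
  let ?V = "(\<lambda>\<sigma>. (1::real, \<sigma>)) ` {0..1::real}"
  obtain r where r: "r > 0" "ball 0 r \<subseteq> U"
    using U openE[of U "(0, 0)"] unfolding zero_prod_def by blast
  \<comment> \<open>Points of rays with parameter at most \<open>\<delta>\<close> have norm at most \<open>2 \<delta> < r\<close>, and \<open>\<delta> < T\<close>.\<close>
  define \<delta> where "\<delta> = min (T / 2) (r / 3)"
  have \<delta>: "\<delta> > 0" using T r by (simp add: \<delta>_def)
  have ray: "t *\<^sub>R v \<in> U \<inter> kernel_domain T" if v: "v \<in> ?V" and t: "t \<in> {0..\<delta>}" for v t
  proof -
    obtain \<sigma> where \<sigma>: "v = (1, \<sigma>)" "\<sigma> \<in> {0..1}" using v by blast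
    have st: "0 \<le> t * \<sigma>" "t * \<sigma> \<le> t * 1"
      using \<sigma>(2) t by (auto intro!: mult_left_mono simp del: mult_1_right mult.right_neutral)
    have "norm (t, t * \<sigma>) \<le> norm t + norm (t * \<sigma>)" by (rule norm_Pair_le)
    also have "\<dots> \<le> \<delta> + \<delta>" using st t by auto
    also have "\<dots> < r" using r by (auto simp: \<delta>_def)
    finally have "(t, t * \<sigma>) \<in> ball 0 r" by simp
    moreover have "t \<le> T" using t T by (auto simp: \<delta>_def)
    ultimately show ?thesis using st r t by (auto simp: \<sigma> kernel_domain_def)
  qed
  have bV: "bounded ?V"
    by (intro compact_imp_bounded compact_continuous_image continuous_intros) simp
  from taylor_along_rays[OF td cont bV \<delta> ray]
  obtain c where c: "\<And>j. continuous_on ?V (c j)" and ex: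
    "\<And>\<epsilon>. \<epsilon> > 0 \<Longrightarrow> \<exists>\<eta>>0. \<forall>t\<in>{0..\<eta>}. \<forall>v\<in>?V. \<bar>h (t *\<^sub>R v) - (\<Sum>j\<le>N. c j v * t ^ j)\<bar> \<le> \<epsilon> * t ^ N"
    by blast
  show ?thesis
    unfolding ray_expandable_def
  proof (intro exI[of _ "\<lambda>j \<sigma>. c j (1, \<sigma>)"] conjI allI impI)
    show "continuous_on {0..1} (\<lambda>\<sigma>. c j (1, \<sigma>))" for j
      by (rule continuous_on_compose2[OF c]) (auto intro!: continuous_intros)
    fix \<epsilon> :: real assume "\<epsilon> > 0"
    from ex[OF this] obtain \<eta> where \<eta>: "\<eta> > 0"
      "\<And>t v. t \<in> {0..\<eta>} \<Longrightarrow> v \<in> ?V \<Longrightarrow> \<bar>h (t *\<^sub>R v) - (\<Sum>j\<le>N. c j v * t ^ j)\<bar> \<le> \<epsilon> * t ^ N"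
      by blast
    show "\<exists>\<eta>>0. \<forall>t\<in>{0..\<eta>}. \<forall>\<sigma>\<in>{0..1}. \<bar>k t (\<sigma> * t) - (\<Sum>j\<le>N. c j (1, \<sigma>) * t ^ j)\<bar> \<le> \<epsilon> * t ^ N"
    proof (intro exI conjI ballI)
      show "min \<eta> \<delta> > 0" using \<eta> \<delta> by simp
      fix t \<sigma> :: real assume t: "t \<in> {0..min \<eta> \<delta>}" and \<sigma>: "\<sigma> \<in> {0..1}"
      have "h (t *\<^sub>R (1, \<sigma>)) = k t (\<sigma> * t)"
      proof -
        have "t *\<^sub>R (1, \<sigma>) \<in> U \<inter> kernel_domain T" using t \<sigma> by (intro ray) auto
        moreover have "t < T" using t T by (auto simp: \<delta>_def)
        ultimately show ?thesis using eq[of t "t * \<sigma>"] by (simp add: mult.commute)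
      qed
      then show "\<bar>k t (\<sigma> * t) - (\<Sum>j\<le>N. c j (1, \<sigma>) * t ^ j)\<bar> \<le> \<epsilon> * t ^ N"
        using \<eta>(2)[of t "(1, \<sigma>)"] t \<sigma> by auto
    qed
  qed
qed

text \<open>By uniqueness of derivatives on an interval, \<open>f'\<close> agrees near 0 with the first derivative that
  \<open>times_differentiable_on\<close> provides for \<open>f\<close>, and that one is \<open>N\<close> times differentiable. Continuity of
  \<open>f'\<close> is what remains of this for \<open>N = 0\<close>.\<close>
lemma taylor_approx_deriv:
  assumes T: "T > 0" and U: "open U" "0 \<in> U"
    and td: "times_differentiable_on (Suc N) f (U \<inter> {0..T})"
    and deriv: "\<And>t. t \<in> {0..T} \<Longrightarrow> (f has_real_derivative f' t) (at t within {0..T})"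
    and cont: "continuous_on {0..T} f'"
  shows "taylor_approx N f'"
proof -
  let ?S = "U \<inter> {0..T}"
  obtain F where F: "\<And>x. x \<in> ?S \<Longrightarrow> (f has_derivative F x) (at x within ?S)"
    and tdF: "\<And>e. times_differentiable_on N (\<lambda>x. F x e) ?S"
    using td unfolding times_differentiable_on.simps by blast
  have eq: "F t 1 = f' t" if t: "t \<in> ?S" for t
  proof -
    interpret bounded_linear "F t" using F[OF t] by (rule has_derivative_bounded_linear)
    have "at t within ?S = at t within {0..T}"
      using t U by (intro at_within_nhd[of _ U]) auto
    then have "(f has_derivative F t) (at t within {0..T})" using F[OF t] by (simp only:)
    moreover have "F t = (\<lambda>h. h *\<^sub>R F t 1)"
    proof
      show "F t h = h *\<^sub>R F t 1" for h using scaleR[of h 1] by simp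
    qed
    ultimately have 1: "(f has_vector_derivative F t 1) (at t within {0..T})"
      unfolding has_vector_derivative_def by (rule has_derivative_eq_rhs)
    have 2: "(f has_vector_derivative f' t) (at t within {0..T})"
      using deriv[of t] t by (simp add: has_real_derivative_iff_has_vector_derivative)
    show ?thesis
      using t by (intro vector_derivative_unique_within_closed_interval[unfolded cbox_interval, OF T _ 1 2]) simp
  qed
  have S0: "0 \<in> ?S" using T U by simp
  have "continuous (at 0 within ?S) f'"
    by (rule continuous_within_subset[of 0 "{0..T}"])
       (use cont T in \<open>auto simp: continuous_on_eq_continuous_within\<close>)
  then have contF: "continuous (at 0 within ?S) (\<lambda>x. F x 1)"
    by (rule continuous_transform_within[OF _ zero_less_one S0]) (simp add: eq)
  obtain r where r: "r > 0" "ball 0 r \<subseteq> U" by (rule openE[OF U])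
  define \<delta> where "\<delta> = min T (r / 2)"
  have \<delta>: "\<delta> > 0" using T r by (simp add: \<delta>_def)
  have ray: "t \<in> ?S" if "t \<in> {0..\<delta>}" for t
    using that r by (auto simp: \<delta>_def subset_iff dist_norm)
  have ray': "t *\<^sub>R v \<in> ?S" if "v \<in> {1}" "t \<in> {0..\<delta>}" for v t
    using ray[OF that(2)] that(1) by simp
  have "bounded {1::real}" by simp
  from taylor_along_rays[OF tdF contF this \<delta> ray']
  obtain c where ex: "\<And>\<epsilon>. \<epsilon> > 0 \<Longrightarrow>
      \<exists>\<eta>>0. \<forall>t\<in>{0..\<eta>}. \<forall>v\<in>{1}. \<bar>F (t *\<^sub>R v) 1 - (\<Sum>j\<le>N. c j v * t ^ j)\<bar> \<le> \<epsilon> * t ^ N"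
    by blast
  show ?thesis
  proof (rule taylor_approxI[where c = "\<lambda>j. c j 1"])
    fix \<epsilon> :: real assume "\<epsilon> > 0"
    from ex[OF this] obtain \<eta> where \<eta>: "\<eta> > 0"
      "\<And>t. t \<in> {0..\<eta>} \<Longrightarrow> \<bar>F t 1 - (\<Sum>j\<le>N. c j 1 * t ^ j)\<bar> \<le> \<epsilon> * t ^ N" by auto
    show "\<exists>\<eta>>0. \<forall>t\<in>{0..\<eta>}. \<bar>f' t - (\<Sum>j\<le>N. c j 1 * t ^ j)\<bar> \<le> \<epsilon> * t ^ N"
    proof (intro exI conjI ballI)
      show "min \<eta> \<delta> > 0" using \<eta> \<delta> by simp
      fix t assume "t \<in> {0..min \<eta> \<delta>}"
      then have "t \<in> {0..\<eta>}" "t \<in> {0..\<delta>}" by auto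
      then show "\<bar>f' t - (\<Sum>j\<le>N. c j 1 * t ^ j)\<bar> \<le> \<epsilon> * t ^ N"
        using \<eta>(2)[of t] eq[OF ray[of t]] by simp
    qed
  qed
qed

section \<open>The method of undetermined coefficients\<close>

text \<open>The functions \<open>t\<^sup>m \<psi>\<^sub>m(t)\<close> start with the monomial \<open>L\<^sub>m t\<^sup>m\<close>, so subtracting suitable multiples of
  them eliminates the Taylor coefficients of \<open>\<phi>\<close> one after the other, from the lowest order
  upwards. This is the solution of a triangular linear system with diagonal \<open>L\<^sub>0, \<dots>, L\<^sub>N\<close>.\<close>
lemma triangular_coefficients_exist:
  fixes \<psi> :: "nat \<Rightarrow> real \<Rightarrow> real" and \<phi> :: "real \<Rightarrow> real"
  assumes lim: "\<And>m. m \<le> N \<Longrightarrow> (\<psi> m \<longlongrightarrow> L m) (at_right 0)" and L: "\<And>m. m \<le> N \<Longrightarrow> L m \<noteq> 0"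
    and \<psi>: "\<And>m. m \<le> N \<Longrightarrow> taylor_approx N (\<psi> m)"
    and \<phi>: "taylor_approx N \<phi>"
  shows "\<exists>x. (\<lambda>t. \<phi> t - (\<Sum>m\<le>N. x m * (t ^ m * \<psi> m t))) \<in> o[at_right 0](\<lambda>t. t ^ N)"
proof -
  have "\<exists>x p. (\<lambda>t. \<phi> t - (\<Sum>m<k. x m * (t ^ m * \<psi> m t)) - t ^ k * poly p t) \<in> o[at_right 0](\<lambda>t. t ^ N)"
    if "k \<le> Suc N" for k
    using that
  proof (induction k)
    case 0
    then show ?case using \<phi> by simp
  next
    case (Suc k)
    then obtain x p where xp: "(\<lambda>t. \<phi> t - (\<Sum>m<k. x m * (t ^ m * \<psi> m t)) - t ^ k * poly p t)
      \<in> o[at_right 0](\<lambda>t. t ^ N)" by auto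
    have k: "k \<le> N" using Suc.prems by simp
    obtain b where b: "(\<lambda>t. \<psi> k t - poly b t) \<in> o[at_right 0](\<lambda>t. t ^ N)"
      using \<psi>[OF k] by blast
    have pb: "poly b 0 = L k"
    proof -
      have "(poly b \<longlongrightarrow> poly b 0) (at_right 0)" by (intro tendsto_intros)
      moreover have "((\<lambda>t. \<psi> k t - (\<psi> k t - poly b t)) \<longlongrightarrow> L k - 0) (at_right 0)"
      proof (intro tendsto_diff lim k)
        have "(\<lambda>t::real. t ^ N) \<in> O[at_right 0](\<lambda>_. 1)"
          by (rule bigoI_tendsto[where c = "0 ^ N"]) (auto intro!: tendsto_eq_intros)
        from landau_o.small_big_trans[OF b this]
        show "((\<lambda>t. \<psi> k t - poly b t) \<longlongrightarrow> 0) (at_right 0)" by (auto dest: smalloD_tendsto)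
      qed
      ultimately show ?thesis
        using tendsto_unique[of "at_right 0" "poly b" "poly b 0" "L k"] by simp
    qed
    \<comment> \<open>This choice makes \<open>p - a b\<close> vanish at 0, hence divisible by the variable.\<close>
    define a where "a = poly p 0 / L k"
    have "poly (p - smult a b) 0 = 0" using L[OF k] by (simp add: a_def pb)
    then obtain r where r: "p - smult a b = [:0, 1:] * r"
      unfolding poly_eq_0_iff_dvd by (auto elim!: dvdE)
    have pe: "poly p t = t * poly r t + a * poly b t" for t
      using arg_cong[OF r, of "\<lambda>p. poly p t"] by (simp add: algebra_simps)
    have "(\<lambda>t. (a * t ^ k) * (\<psi> k t - poly b t)) \<in> o[at_right 0](\<lambda>t. t ^ N)"
      by (rule bounded_smallo_at_right_0[OF _ b, where L = "a * 0 ^ k"]) (intro tendsto_intros)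
    from sum_in_smallo(2)[OF xp this]
    have "(\<lambda>t. \<phi> t - (\<Sum>m<Suc k. (x(k := a)) m * (t ^ m * \<psi> m t)) - t ^ Suc k * poly r t)
       \<in> o[at_right 0](\<lambda>t. t ^ N)"
      by (simp add: pe algebra_simps cong: sum.cong_simp)
    then show ?case by blast
  qed
  from this[of "Suc N"] obtain x p where
    "(\<lambda>t. \<phi> t - (\<Sum>m<Suc N. x m * (t ^ m * \<psi> m t)) - t ^ Suc N * poly p t) \<in> o[at_right 0](\<lambda>t. t ^ N)"
    by auto
  moreover have "(\<lambda>t. poly p t * t ^ Suc N) \<in> o[at_right 0](\<lambda>t. t ^ N)"
    by (rule bounded_smallo_at_right_0[where L = "poly p 0"])
       (auto intro!: tendsto_intros power_smallo_at_right_0 simp del: power_Suc)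
  ultimately have "(\<lambda>t. (\<phi> t - (\<Sum>m<Suc N. x m * (t ^ m * \<psi> m t)) - t ^ Suc N * poly p t)
      + poly p t * t ^ Suc N) \<in> o[at_right 0](\<lambda>t. t ^ N)"
    by (rule sum_in_smallo)
  then show ?thesis by (auto simp: lessThan_Suc_atMost mult.commute[of "poly p _"] simp del: power_Suc)
qed

text \<open>Divide by the power \<open>t\<^sup>k\<close> of the first nonvanishing coefficient: the sum then tends to
  \<open>z\<^sub>k L\<^sub>k\<close>, but a function of order \<open>o(t\<^sup>N)\<close> tends to 0.\<close>
lemma triangular_coefficients_unique:
  fixes \<psi> :: "nat \<Rightarrow> real \<Rightarrow> real" and z L :: "nat \<Rightarrow> real"
  assumes lim: "\<And>m. m \<le> N \<Longrightarrow> (\<psi> m \<longlongrightarrow> L m) (at_right 0)" and L: "\<And>m. m \<le> N \<Longrightarrow> L m \<noteq> 0"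
    and o: "(\<lambda>t. \<Sum>m\<le>N. z m * (t ^ m * \<psi> m t)) \<in> o[at_right 0](\<lambda>t. t ^ N)"
    and "i \<le> N"
  shows "z i = 0"
  using \<open>i \<le> N\<close>
proof (induction i rule: less_induct)
  case (less k)
  let ?g = "\<lambda>t. \<Sum>m\<in>{k..N}. z m * (t ^ (m - k) * \<psi> m t)"
  have ev: "\<forall>\<^sub>F t in at_right 0. t > (0::real)" by (simp add: eventually_at_filter)
  have "(\<Sum>m\<le>N. z m * (t ^ m * \<psi> m t)) = t ^ k * ?g t" for t
  proof -
    have "(\<Sum>m\<le>N. z m * (t ^ m * \<psi> m t)) = (\<Sum>m\<in>{k..N}. z m * (t ^ m * \<psi> m t))"
      using less by (intro sum.mono_neutral_right) auto
    also have "\<dots> = t ^ k * ?g t"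
      unfolding sum_distrib_left
      by (intro sum.cong refl) (simp add: power_add[symmetric] flip: mult.assoc mult.commute[of "z _"])
    finally show ?thesis .
  qed
  with o have "(\<lambda>t. t ^ k * ?g t) \<in> o[at_right 0](\<lambda>t. t ^ N)" by simp
  also have "(\<lambda>t::real. t ^ N) \<in> O[at_right 0](\<lambda>t. t ^ k * 1)"
  proof (rule bigoI_tendsto[where c = "0 ^ (N - k)"])
    have "((\<lambda>t::real. t ^ (N - k)) \<longlongrightarrow> 0 ^ (N - k)) (at_right 0)" by (intro tendsto_intros)
    then show "((\<lambda>t::real. t ^ N / (t ^ k * 1)) \<longlongrightarrow> 0 ^ (N - k)) (at_right 0)"
      by (rule Lim_transform_eventually)
         (use ev less.prems in \<open>auto simp: power_diff elim!: eventually_mono\<close>)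
    next
    show "\<forall>\<^sub>F t in at_right 0. (t::real) ^ k * 1 \<noteq> 0"
      using ev by (rule eventually_mono) auto
  qed
  finally have "?g \<in> o[at_right 0](\<lambda>_. 1)"
    using eventually_mono[OF ev, of "\<lambda>t. t ^ k \<noteq> 0"]
    by (subst (asm) landau_o.small.mult_cancel_left) auto
  then have "(?g \<longlongrightarrow> 0) (at_right 0)" by (auto dest: smalloD_tendsto)
  moreover have "(?g \<longlongrightarrow> (\<Sum>m\<in>{k..N}. z m * (0 ^ (m - k) * L m))) (at_right 0)"
    by (intro tendsto_intros lim) auto
  moreover have "(\<Sum>m\<in>{k..N}. z m * (0 ^ (m - k) * L m)) = (\<Sum>m\<in>{k}. z m * (0 ^ (m - k) * L m))"
    using less.prems by (intro sum.mono_neutral_right) auto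
  ultimately have "z k * L k = 0" using tendsto_unique[of "at_right (0::real)"] by fastforce
  then show ?case using L less.prems by simp
qed

section \<open>Contractions in the space of continuous functions\<close>

lemma C_spaceI: "continuous_on {0..T} u \<Longrightarrow> (\<lambda>t\<in>{0..T}. u t) \<in> C_space T"
  unfolding C_space_def by (auto cong: continuous_on_cong_simp)

lemma C_space_eqI:
  "\<lbrakk>a \<in> C_space T; b \<in> C_space T; \<And>t. t \<in> {0..T} \<Longrightarrow> a t = b t\<rbrakk> \<Longrightarrow> a = b"
  by (auto simp: C_space_def intro: extensionalityI)

lemma C_space_bounded:
  assumes "u \<in> C_space T"
  shows "\<exists>B. \<forall>t\<in>{0..T}. \<bar>u t\<bar> \<le> B"
proof -
  have "bounded (u ` {0..T})"
    using assms by (intro compact_imp_bounded compact_continuous_image) (auto simp: C_space_def)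
  then show ?thesis by (auto simp: bounded_iff)
qed

lemma max_norm_upper:
  assumes "u \<in> C_space T" "t \<in> {0..T}"
  shows "\<bar>u t\<bar> \<le> max_norm T u"
proof -
  obtain B where "\<And>t. t \<in> {0..T} \<Longrightarrow> \<bar>u t\<bar> \<le> B" using C_space_bounded[OF assms(1)] by blast
  then show ?thesis unfolding max_norm_def by (intro cSUP_upper[OF assms(2)] bdd_aboveI2)
qed

lemma max_norm_least:
  assumes "0 \<le> T" "\<And>t. t \<in> {0..T} \<Longrightarrow> \<bar>u t\<bar> \<le> B"
  shows "max_norm T u \<le> B"
  unfolding max_norm_def using assms by (intro cSUP_least) auto

lemma max_norm_nonneg:
  assumes "0 \<le> T" "\<And>t. t \<in> {0..T} \<Longrightarrow> \<bar>u t\<bar> \<le> B"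
  shows "0 \<le> max_norm T u"
proof -
  have "\<bar>u 0\<bar> \<le> max_norm T u"
    unfolding max_norm_def using assms by (intro cSUP_upper bdd_aboveI2) auto
  then show ?thesis by linarith
qed

text \<open>The contraction principle for the weighted norm \<open>sup \<bar>u(t)\<bar> exp (- \<kappa> t)\<close>. The contraction
  property is stated through pointwise bounds, so that it can be applied without introducing that
  norm. On \<open>[0,T]\<close> the norm is equivalent to the maximum norm, which gives convergence in the latter.\<close>
lemma C_space_fixed_point:
  assumes T: "0 \<le> T" and \<kappa>: "0 \<le> \<kappa>" and \<theta>: "0 \<le> \<theta>" "\<theta> < 1"
    and maps: "\<And>u. u \<in> C_space T \<Longrightarrow> \<Phi> u \<in> C_space T"
    and contr: "\<And>a b B t. \<lbrakk>a \<in> C_space T; b \<in> C_space T;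
      \<And>t. t \<in> {0..T} \<Longrightarrow> \<bar>a t - b t\<bar> \<le> B * exp (\<kappa> * t); t \<in> {0..T}\<rbrakk>
      \<Longrightarrow> \<bar>\<Phi> a t - \<Phi> b t\<bar> \<le> \<theta> * B * exp (\<kappa> * t)"
  obtains u where "u \<in> C_space T" "\<Phi> u = u" "\<And>w. w \<in> C_space T \<Longrightarrow> \<Phi> w = w \<Longrightarrow> w = u"
    "\<And>us. us 0 \<in> C_space T \<Longrightarrow> (\<And>m. us (Suc m) = \<Phi> (us m)) \<Longrightarrow>
      (\<forall>m. us m \<in> C_space T) \<and> (\<lambda>m. max_norm T (\<lambda>t. us m t - u t)) \<longlonglongrightarrow> 0"
proof -
  define v where "v m = (\<Phi> ^^ m) (\<lambda>t\<in>{0..T}. 0)" for m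
  have v: "v m \<in> C_space T" for m
    unfolding v_def by (induction m) (auto simp: maps C_spaceI simp del: restrict_apply)
  have vS: "v (Suc m) = \<Phi> (v m)" for m by (simp add: v_def)
  have dist_bd: "\<exists>B\<ge>0. \<forall>t\<in>{0..T}. \<bar>a t - b t\<bar> \<le> B * exp (\<kappa> * t)"
    if ab: "a \<in> C_space T" "b \<in> C_space T" for a b
  proof -
    obtain A where A: "\<And>t. t \<in> {0..T} \<Longrightarrow> \<bar>a t\<bar> \<le> A" using C_space_bounded[OF ab(1)] by blast
    obtain B where B: "\<And>t. t \<in> {0..T} \<Longrightarrow> \<bar>b t\<bar> \<le> B" using C_space_bounded[OF ab(2)] by blast
    show ?thesis
    proof (intro exI conjI ballI)
      show "A + B \<ge> 0" using A[of 0] B[of 0] T by simp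
      fix t assume t: "t \<in> {0..T}"
      have "\<bar>a t - b t\<bar> \<le> (A + B) * 1" using A[OF t] B[OF t] by simp
      also have "\<dots> \<le> (A + B) * exp (\<kappa> * t)"
        using t \<kappa> A[of 0] B[of 0] T by (intro mult_left_mono) auto
      finally show "\<bar>a t - b t\<bar> \<le> (A + B) * exp (\<kappa> * t)" .
    qed
  qed
  have expT: "B * exp (\<kappa> * t) \<le> B * exp (\<kappa> * T)" if "B \<ge> 0" "t \<in> {0..T}" for B t
    using that \<kappa> by (auto intro!: mult_left_mono)
  obtain B where B: "B \<ge> 0" "\<And>t. t \<in> {0..T} \<Longrightarrow> \<bar>v 1 t - v 0 t\<bar> \<le> B * exp (\<kappa> * t)"
    using dist_bd[OF v v] by blast
  have step: "\<forall>t\<in>{0..T}. \<bar>v (Suc m) t - v m t\<bar> \<le> \<theta> ^ m * B * exp (\<kappa> * t)" for m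
  proof (induction m)
    case (Suc m)
    then show ?case
      using contr[OF v v, of "Suc m" m "\<theta> ^ m * B"] by (auto simp: vS mult_ac)
  qed (use B in simp)
  have "uniformly_convergent_on {0..T} (\<lambda>k t. \<Sum>m<k. v (Suc m) t - v m t)"
  proof (rule Weierstrass_m_test')
    fix m t assume t: "t \<in> {0..T}"
    show "norm (v (Suc m) t - v m t) \<le> \<theta> ^ m * (B * exp (\<kappa> * T))"
      using step[of m] t expT[of "\<theta> ^ m * B" t] B \<theta> by (fastforce simp: mult.assoc)
  next
    show "summable (\<lambda>m. \<theta> ^ m * (B * exp (\<kappa> * T)))"
      using \<theta> by (intro summable_mult2 summable_geometric) auto
  qed
  then obtain l where l: "uniform_limit {0..T} (\<lambda>k t. \<Sum>m<k. v (Suc m) t - v m t) l sequentially"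
    by (auto simp: uniformly_convergent_on_def)
  define u where "u = (\<lambda>t\<in>{0..T}. l t)"
  have ul: "uniform_limit {0..T} v u sequentially"
  proof -
    have "(\<Sum>m<k. v (Suc m) t - v m t) = v k t" if "t \<in> {0..T}" for k t
      using that by (subst sum_lessThan_telescope) (simp add: v_def)
    then show ?thesis
      using l by (subst uniform_limit_cong'[where g = "\<lambda>k t. \<Sum>m<k. v (Suc m) t - v m t" and i = l])
        (auto simp: u_def)
  qed
  have uC: "u \<in> C_space T"
  proof -
    have "continuous_on {0..T} u"
      using v by (intro uniform_limit_theorem[OF _ ul]) (auto simp: C_space_def)
    then show ?thesis by (simp add: C_space_def u_def)
  qed
  have fix_u: "\<Phi> u = u"
  proof (rule C_space_eqI[OF maps[OF uC] uC])
    fix t assume t: "t \<in> {0..T}"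
    have "(\<lambda>m. v (Suc m) t) \<longlonglongrightarrow> \<Phi> u t"
    proof (rule LIMSEQ_I)
      fix r :: real assume r: "r > 0"
      let ?r = "r / (2 * exp (\<kappa> * T))"
      have "?r > 0" using r by simp
      from uniform_limitD[OF ul this] obtain M where
        M: "\<And>m t. m \<ge> M \<Longrightarrow> t \<in> {0..T} \<Longrightarrow> \<bar>v m t - u t\<bar> < ?r"
        unfolding eventually_sequentially dist_real_def by blast
      have "norm (v (Suc m) t - \<Phi> u t) < r" if m: "m \<ge> M" for m
      proof -
        have "\<bar>v m s - u s\<bar> \<le> ?r * exp (\<kappa> * s)" if s: "s \<in> {0..T}" for s
        proof -
          have "?r * 1 \<le> ?r * exp (\<kappa> * s)" using s \<kappa> r by (intro mult_left_mono) auto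
          then show ?thesis using M[OF m s] by linarith
        qed
        from contr[OF v uC this t] have "\<bar>v (Suc m) t - \<Phi> u t\<bar> \<le> \<theta> * (?r * exp (\<kappa> * t))"
          by (simp add: vS mult.assoc)
        also have "\<dots> \<le> 1 * (?r * exp (\<kappa> * T))"
          using \<theta> r t \<kappa> by (intro mult_mono) (auto intro: mult_left_mono)
        also have "\<dots> < r" using r by simp
        finally show ?thesis by simp
      qed
      then show "\<exists>no. \<forall>m\<ge>no. norm (v (Suc m) t - \<Phi> u t) < r" by blast
    qed
    moreover have "(\<lambda>m. v (Suc m) t) \<longlonglongrightarrow> u t"
      using tendsto_uniform_limitI[OF ul t] by (rule LIMSEQ_Suc)
    ultimately show "\<Phi> u t = u t" by (rule LIMSEQ_unique)
  qed
  have orbit: "(\<forall>m. us m \<in> C_space T) \<and> (\<lambda>m. max_norm T (\<lambda>t. us m t - u t)) \<longlonglongrightarrow> 0"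
    if us: "us 0 \<in> C_space T" "\<And>m. us (Suc m) = \<Phi> (us m)" for us
  proof
    have usC: "us m \<in> C_space T" for m by (induction m) (auto simp: us maps)
    then show "\<forall>m. us m \<in> C_space T" by blast
    obtain D where D: "D \<ge> 0" "\<And>t. t \<in> {0..T} \<Longrightarrow> \<bar>us 0 t - u t\<bar> \<le> D * exp (\<kappa> * t)"
      using dist_bd[OF usC uC] by blast
    have bd: "\<forall>t\<in>{0..T}. \<bar>us m t - u t\<bar> \<le> \<theta> ^ m * D * exp (\<kappa> * t)" for m
    proof (induction m)
      case (Suc m)
      then show ?case
        using contr[OF usC uC, of m "\<theta> ^ m * D"] by (auto simp: us fix_u mult_ac)
    qed (use D in simp)
    have bd': "\<bar>us m t - u t\<bar> \<le> \<theta> ^ m * (D * exp (\<kappa> * T))" if "t \<in> {0..T}" for m t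
    proof -
      have "\<bar>us m t - u t\<bar> \<le> \<theta> ^ m * D * exp (\<kappa> * t)" using bd that by blast
      also have "\<dots> \<le> \<theta> ^ m * D * exp (\<kappa> * T)" using that D \<theta> by (intro expT) auto
      finally show ?thesis by (simp only: mult.assoc)
    qed
    have lim0: "(\<lambda>m. \<theta> ^ m * (D * exp (\<kappa> * T))) \<longlonglongrightarrow> 0"
      using \<theta> by (intro tendsto_mult_left_zero LIMSEQ_power_zero) auto
    have bd_norm: "norm (max_norm T (\<lambda>t. us m t - u t)) \<le> \<theta> ^ m * (D * exp (\<kappa> * T))" for m
      using max_norm_nonneg[OF T, of "\<lambda>t. us m t - u t", OF bd']
        max_norm_least[OF T, of "\<lambda>t. us m t - u t", OF bd'] by simp
    have "\<forall>\<^sub>F m in sequentially. norm (max_norm T (\<lambda>t. us m t - u t)) \<le> \<theta> ^ m * (D * exp (\<kappa> * T))"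
      by (intro always_eventually allI bd_norm)
    then show "(\<lambda>m. max_norm T (\<lambda>t. us m t - u t)) \<longlonglongrightarrow> 0"
      by (rule Lim_null_comparison[OF _ lim0])
  qed
  have uniq: "w = u" if w: "w \<in> C_space T" "\<Phi> w = w" for w
  proof (rule C_space_eqI[OF w(1) uC])
    fix t assume t: "t \<in> {0..T}"
    have "(\<lambda>m::nat. max_norm T (\<lambda>t. w t - u t)) \<longlonglongrightarrow> 0"
      using orbit[of "\<lambda>_. w"] w by simp
    then have 0: "max_norm T (\<lambda>t. w t - u t) = 0" by (simp add: LIMSEQ_const_iff)
    have "(\<lambda>t\<in>{0..T}. w t - u t) \<in> C_space T"
      using w uC by (intro C_spaceI continuous_intros) (auto simp: C_space_def)
    from max_norm_upper[OF this t] have "\<bar>w t - u t\<bar> \<le> max_norm T (\<lambda>t\<in>{0..T}. w t - u t)"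
      using t by simp
    also have "\<dots> = max_norm T (\<lambda>t. w t - u t)"
      unfolding max_norm_def by (intro SUP_cong) auto
    finally show "w t = u t" using 0 by simp
  qed
  show ?thesis using that[OF uC fix_u uniq orbit] by blast
qed

section \<open>Differentiation of integrals over the triangle\<close>

text \<open>Leibniz' rule under an integral whose upper end moves with the parameter. For \<open>b = 1\<close> the
  difference quotient in \<open>t\<close> needs values of \<open>k\<close> above the diagonal \<open>s = t\<close>, where \<open>k\<close> is not given.
  The kernel is therefore continued beyond the diagonal by its first order Taylor polynomial; then
  both partial derivatives of \<open>(t, x) \<mapsto> \<integral>\<^sub>0\<^sup>x k(t,s) y(s) ds\<close> exist on a square and the chain rule applies.\<close>
lemma leibniz_triangle:
  fixes k k' :: "real \<Rightarrow> real \<Rightarrow> real"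
  assumes k: "continuous_on (kernel_domain T) (\<lambda>(t, s). k t s)"
    and deriv: "\<And>t s. (t, s) \<in> kernel_domain T \<Longrightarrow>
      ((\<lambda>\<tau>. k \<tau> s) has_real_derivative k' t s) (at t within {s..T})"
    and k': "continuous_on (kernel_domain T) (\<lambda>(t, s). k' t s)"
    and y: "continuous_on {0..T} y" and b: "0 \<le> b" "b \<le> 1" and t: "t \<in> {0..T}"
  shows "((\<lambda>t. integral {0..b * t} (\<lambda>s. k t s * y s)) has_real_derivative
    b * (k t (b * t) * y (b * t)) + integral {0..b * t} (\<lambda>s. k' t s * y s)) (at t within {0..T})"
proof -
  define kx where "kx t s = k (max t s) s + min (t - s) 0 * k' s s" for t s
  define kx' where "kx' t s = k' (max t s) s" for t s
  let ?I = "{0..T}"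
  have into: "(max (fst p) (snd p), snd p) \<in> kernel_domain T" "(snd p, snd p) \<in> kernel_domain T"
    if "p \<in> ?I \<times> ?I" for p
    using that by (auto simp: kernel_domain_def)
  have cont_max: "continuous_on (?I \<times> ?I) (\<lambda>p. g (max (fst p) (snd p)) (snd p))"
    if g: "continuous_on (kernel_domain T) (\<lambda>(t, s). g t s)" for g :: "real \<Rightarrow> real \<Rightarrow> real"
  proof -
    have "continuous_on (?I \<times> ?I) (\<lambda>p. (\<lambda>(t, s). g t s) (max (fst p) (snd p), snd p))"
      by (rule continuous_on_compose2[OF g]) (use into in \<open>auto intro!: continuous_intros\<close>)
    then show ?thesis by simp
  qed
  have cont_diag: "continuous_on (?I \<times> ?I) (\<lambda>p. k' (snd p) (snd p))"
  proof -
    have "continuous_on (?I \<times> ?I) (\<lambda>p. (\<lambda>(t, s). k' t s) (snd p, snd p))"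
      by (rule continuous_on_compose2[OF k']) (use into in \<open>auto intro!: continuous_intros\<close>)
    then show ?thesis by simp
  qed
  have cont_kx: "continuous_on (?I \<times> ?I) (\<lambda>p. kx (fst p) (snd p))"
    unfolding kx_def by (intro continuous_on_add continuous_on_mult cont_max[OF k] cont_diag)
      (intro continuous_intros)
  have cont_kx': "continuous_on (?I \<times> ?I) (\<lambda>p. kx' (fst p) (snd p))"
    unfolding kx'_def by (rule cont_max[OF k'])
  have kx_deriv: "((\<lambda>\<tau>. kx \<tau> s) has_real_derivative kx' \<tau> s) (at \<tau> within ?I)"
    if s: "s \<in> ?I" and \<tau>: "\<tau> \<in> ?I" for \<tau> s
  proof -
    have "((\<lambda>\<tau>. kx \<tau> s) has_real_derivative kx' \<tau> s) (at \<tau> within {0..s})"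
    proof (cases "\<tau> \<le> s")
      case True
      have "((\<lambda>\<tau>. k s s + (\<tau> - s) * k' s s) has_real_derivative kx' \<tau> s) (at \<tau> within {0..s})"
        using True by (auto intro!: derivative_eq_intros simp: kx'_def max_def)
      then show ?thesis
        using True \<tau> by (elim has_field_derivative_transform_within[where d = 1]) (auto simp: kx_def max_def min_def)
    next
      case False
      then have "at \<tau> within {0..s} = bot" by (intro not_in_closure_trivial_limitI) simp
      then show ?thesis by (simp add: has_field_derivative_iff)
    qed
    moreover have "((\<lambda>\<tau>. kx \<tau> s) has_real_derivative kx' \<tau> s) (at \<tau> within {s..T})"
    proof (cases "\<tau> \<ge> s")
      case True
      have "((\<lambda>\<tau>. k \<tau> s) has_real_derivative kx' \<tau> s) (at \<tau> within {s..T})"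
        using deriv[of \<tau> s] True s \<tau> by (simp add: kx'_def kernel_domain_def max_def)
      then show ?thesis
        using True \<tau> by (elim has_field_derivative_transform_within[where d = 1]) (auto simp: kx_def max_def min_def)
    next
      case False
      then have "at \<tau> within {s..T} = bot" by (intro not_in_closure_trivial_limitI) simp
      then show ?thesis by (simp add: has_field_derivative_iff)
    qed
    moreover have "at \<tau> within ?I = sup (at \<tau> within {0..s}) (at \<tau> within {s..T})"
      using s by (simp add: ivl_disj_un_two_touch(4) flip: at_within_union)
    ultimately show ?thesis
      unfolding has_field_derivative_iff by (simp only: filterlim_sup)
  qed
  define G where "G t x = integral {0..x} (\<lambda>s. kx t s * y s)" for t x
  have cont_row: "continuous_on {0..T} (\<lambda>s. kx \<tau> s * y s)" if "\<tau> \<in> ?I" for \<tau>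
  proof -
    have "continuous_on {0..T} (\<lambda>s. (\<lambda>p. kx (fst p) (snd p)) (\<tau>, s))"
      by (rule continuous_on_compose2[OF cont_kx]) (use that in \<open>auto intro!: continuous_intros\<close>)
    then show ?thesis by (intro continuous_on_mult y) simp
  qed
  have bt: "b * \<tau> \<in> ?I" "b * \<tau> \<le> \<tau>" if "\<tau> \<in> ?I" for \<tau>
  proof -
    have "b * \<tau> \<le> 1 * \<tau>" using that b by (intro mult_right_mono) auto
    then show "b * \<tau> \<in> ?I" "b * \<tau> \<le> \<tau>" using that b by auto
  qed
  \<comment> \<open>Joint differentiability needs continuity of just one partial derivative; that in the upper
    limit \<open>x\<close>, the integrand itself, is visibly continuous.\<close>
  have "((\<lambda>(t, x). G t x) has_derivative (\<lambda>(h, j). integral {0..b * t} (\<lambda>s. kx' t s * y s) * h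
      + blinfun_mult_right (kx t (b * t) * y (b * t)) j)) (at (t, b * t) within ?I \<times> ?I)"
  proof (rule has_derivative_partialsI)
    have "((\<lambda>\<tau>. integral (cbox 0 (b * t)) (\<lambda>s. kx \<tau> s * y s)) has_real_derivative
        integral (cbox 0 (b * t)) (\<lambda>s. kx' t s * y s)) (at t within ?I)"
    proof (rule leibniz_rule_field_derivative[OF _ _ _ t])
      fix \<tau> s assume "\<tau> \<in> ?I" "s \<in> cbox 0 (b * t)"
      then show "((\<lambda>\<tau>. kx \<tau> s * y s) has_real_derivative kx' \<tau> s * y s) (at \<tau> within ?I)"
        using bt[OF t] t by (intro DERIV_cmult_right kx_deriv) auto
    next
      fix \<tau> assume "\<tau> \<in> ?I"
      then show "(\<lambda>s. kx \<tau> s * y s) integrable_on cbox 0 (b * t)"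
        using bt[OF t] by (intro integrable_continuous continuous_on_subset[OF cont_row]) auto
    next
      show "continuous_on (?I \<times> cbox 0 (b * t)) (\<lambda>(\<tau>, s). kx' \<tau> s * y s)"
        unfolding split_beta using bt[OF t]
        by (intro continuous_on_mult continuous_on_subset[OF cont_kx'] continuous_on_compose2[OF y])
           (auto intro!: continuous_intros)
    qed simp
    then show "((\<lambda>\<tau>. G \<tau> (b * t)) has_derivative (*) (integral {0..b * t} (\<lambda>s. kx' t s * y s))) (at t within ?I)"
      by (simp add: G_def has_field_derivative_def)
  next
    fix \<tau> x assume "\<tau> \<in> ?I" "x \<in> ?I"
    then have "((\<lambda>x. G \<tau> x) has_real_derivative kx \<tau> x * y x) (at x within ?I)"
      unfolding G_def by (intro integral_has_real_derivative cont_row)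
    then show "((\<lambda>x. G \<tau> x) has_derivative blinfun_mult_right (kx \<tau> x * y x)) (at x within ?I)"
      by (simp add: has_field_derivative_def)
  next
    have "continuous_on (?I \<times> ?I) (\<lambda>p. blinfun_mult_right (kx (fst p) (snd p) * y (snd p)))"
      by (intro bounded_linear.continuous_on[OF bounded_linear_blinfun_mult_right]
            continuous_on_mult cont_kx continuous_on_compose2[OF y])
         (auto intro!: continuous_intros)
    then show "continuous (at (t, b * t) within ?I \<times> ?I) (\<lambda>(\<tau>, x). blinfun_mult_right (kx \<tau> x * y x))"
      using t bt[OF t] unfolding split_beta
      by (intro continuous_on_eq_continuous_within[THEN iffD1, rule_format, of "?I \<times> ?I"]) simp_all
  qed (use bt[OF t] in auto)
  then have outer: "((\<lambda>(t, x). G t x) has_derivative (\<lambda>(h, j). integral {0..b * t} (\<lambda>s. kx' t s * y s) * h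
      + blinfun_mult_right (kx t (b * t) * y (b * t)) j)) (at (t, b * t) within (\<lambda>\<tau>. (\<tau>, b * \<tau>)) ` ?I)"
    by (rule has_derivative_subset) (use bt in auto)
  have "((\<lambda>\<tau>. (\<tau>, b * \<tau>)) has_derivative (\<lambda>h. (h, b * h))) (at t within ?I)"
    by (auto intro!: derivative_eq_intros)
  from has_derivative_in_compose[OF this outer]
  have "((\<lambda>\<tau>. G \<tau> (b * \<tau>)) has_derivative (\<lambda>h. integral {0..b * t} (\<lambda>s. kx' t s * y s) * h
      + kx t (b * t) * y (b * t) * (b * h))) (at t within ?I)"
    by simp
  then have *: "((\<lambda>\<tau>. G \<tau> (b * \<tau>)) has_real_derivative b * (kx t (b * t) * y (b * t))
      + integral {0..b * t} (\<lambda>s. kx' t s * y s)) (at t within ?I)"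
    unfolding has_field_derivative_def
    by (rule has_derivative_eq_rhs) (simp add: fun_eq_iff algebra_simps)
  have kx: "kx \<tau> s = k \<tau> s" "kx' \<tau> s = k' \<tau> s" if "s \<le> \<tau>" for \<tau> s
    using that by (simp_all add: kx_def kx'_def max_def min_def)
  have G: "G \<tau> (b * \<tau>) = integral {0..b * \<tau>} (\<lambda>s. k \<tau> s * y s)" if "\<tau> \<in> ?I" for \<tau>
    unfolding G_def using bt[OF that] by (intro integral_cong) (simp add: kx)
  have "b * (kx t (b * t) * y (b * t)) + integral {0..b * t} (\<lambda>s. kx' t s * y s)
      = b * (k t (b * t) * y (b * t)) + integral {0..b * t} (\<lambda>s. k' t s * y s)"
    using bt[OF t] by (intro arg_cong2[of _ _ _ _ "(+)"] integral_cong) (simp_all add: kx)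
  from has_field_derivative_transform_within[OF *[unfolded this] zero_less_one t G]
  show ?thesis .
qed

section \<open>Integrals with a piecewise continuous kernel\<close>

lemma integral_scale_interval:
  fixes \<phi> :: "real \<Rightarrow> real"
  assumes "0 \<le> t"
  shows "integral {a * t..b * t} \<phi> = t * integral {a..b} (\<lambda>\<sigma>. \<phi> (\<sigma> * t))"
proof (cases "t = 0")
  case False
  then have "(\<lambda>x. x / t) ` {a * t..b * t} = {a..b}"
    using assms by (auto simp: image_iff field_simps intro!: bexI[of _ "_ * t"])
  then show ?thesis
    using integral_stretch_real[of t "a * t" "b * t" \<phi>] False assms by (simp add: mult.commute)
qed simp

text \<open>After the substitution \<open>s = \<sigma> t\<close> the special value at \<open>t = 0\<close> in the definition of the operator is
  given by the same formula as for \<open>t > 0\<close>, which makes continuity at 0 evident.\<close>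
lemma op_V_apply:
  assumes "t \<in> {0..T}"
  shows "op_V T n \<alpha> K K' N u t = (\<Sum>i=1..n. t * integral {\<alpha> (i - 1)..\<alpha> i}
    (\<lambda>\<sigma>. K' i t (\<sigma> * t) * \<sigma> ^ N * u (\<sigma> * t))) / K n t t"
proof (cases "t = 0")
  case False
  have *: "integral {\<alpha> (i - 1) * t..\<alpha> i * t} (\<lambda>s. K' i t s / K n t t * (s / t) ^ N * u s)
      = t * integral {\<alpha> (i - 1)..\<alpha> i} (\<lambda>\<sigma>. K' i t (\<sigma> * t) * \<sigma> ^ N * u (\<sigma> * t)) / K n t t" for i
  proof -
    have "(\<lambda>\<sigma>. K' i t (\<sigma> * t) / K n t t * (\<sigma> * t / t) ^ N * u (\<sigma> * t))
      = (\<lambda>\<sigma>. K' i t (\<sigma> * t) * \<sigma> ^ N * u (\<sigma> * t) / K n t t)"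
      using False by simp
    then show ?thesis
      using integral_scale_interval[of t "\<alpha> (i - 1)" "\<alpha> i"] assms by (simp add: False)
  qed
  have "op_V T n \<alpha> K K' N u t = (\<Sum>i=1..n. integral {\<alpha> (i - 1) * t..\<alpha> i * t}
      (\<lambda>s. K' i t s / K n t t * (s / t) ^ N * u s))"
    using False assms by (simp add: op_V_def)
  then show ?thesis unfolding * by (simp only: sum_divide_distrib)
qed (use assms in \<open>simp add: op_V_def\<close>)

locale piecewise_kernel =
  fixes T :: real and n :: nat and \<alpha> :: "nat \<Rightarrow> real" and K K' :: "nat \<Rightarrow> real \<Rightarrow> real \<Rightarrow> real"
  assumes T_pos: "T > 0" and n_pos: "n \<ge> 1"
    and \<alpha>_0: "\<alpha> 0 = 0" and \<alpha>_n: "\<alpha> n = 1" and \<alpha>_mono: "strict_mono_on {0..n} \<alpha>"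
    and K_cont: "\<And>i. i \<in> {1..n} \<Longrightarrow> continuous_on (kernel_domain T) (\<lambda>(t, s). K i t s)"
    and K_deriv: "\<And>i t s. i \<in> {1..n} \<Longrightarrow> (t, s) \<in> kernel_domain T \<Longrightarrow>
           ((\<lambda>\<tau>. K i \<tau> s) has_real_derivative K' i t s) (at t within {s..T})"
    and K'_cont: "\<And>i. i \<in> {1..n} \<Longrightarrow> continuous_on (kernel_domain T) (\<lambda>(t, s). K' i t s)"
begin

lemma \<alpha>_le: "i \<le> j \<Longrightarrow> j \<le> n \<Longrightarrow> \<alpha> i \<le> \<alpha> j"
  using strict_mono_onD[OF \<alpha>_mono, of i j] by (cases "i = j") auto

lemma \<alpha>_bounds: "i \<le> n \<Longrightarrow> \<alpha> i \<in> {0..1}"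
  using \<alpha>_le[of 0 i] \<alpha>_le[of i n] by (simp add: \<alpha>_0 \<alpha>_n)

lemma \<alpha>_step:
  assumes "i \<in> {1..n}"
  shows "\<alpha> i \<in> {0..1}" "\<alpha> (i - 1) \<in> {0..1}" "\<alpha> (i - 1) \<le> \<alpha> i" "{\<alpha> (i - 1)..\<alpha> i} \<subseteq> {0..1}"
  using assms \<alpha>_bounds[of i] \<alpha>_bounds[of "i - 1"] \<alpha>_le[of "i - 1" i] by auto

lemma ray_mem: "t \<in> {0..T} \<Longrightarrow> \<sigma> \<in> {0..1} \<Longrightarrow> \<sigma> * t \<in> {0..T} \<and> \<sigma> * t \<le> t \<and> (t, \<sigma> * t) \<in> kernel_domain T"
  using mult_right_mono[of \<sigma> 1 t] by (auto simp: kernel_domain_def)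

lemma K_cont_comp:
  assumes "i \<in> {1..n}" "continuous_on S a" "continuous_on S b" "\<And>p. p \<in> S \<Longrightarrow> (a p, b p) \<in> kernel_domain T"
  shows "continuous_on S (\<lambda>p. K i (a p) (b p))" "continuous_on S (\<lambda>p. K' i (a p) (b p))"
proof -
  have ab: "continuous_on S (\<lambda>p. (a p, b p))" "(\<lambda>p. (a p, b p)) ` S \<subseteq> kernel_domain T"
    using assms by (auto intro!: continuous_intros)
  have "continuous_on S (\<lambda>p. (\<lambda>(t, s). K i t s) (a p, b p))" "continuous_on S (\<lambda>p. (\<lambda>(t, s). K' i t s) (a p, b p))"
    by (fact continuous_on_compose2[OF K_cont[OF assms(1)] ab]
        continuous_on_compose2[OF K'_cont[OF assms(1)] ab])+
  then show "continuous_on S (\<lambda>p. K i (a p) (b p))" "continuous_on S (\<lambda>p. K' i (a p) (b p))" by simp_all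
qed

lemma kernel_eq:
  assumes i: "i \<in> {1..n}" and t: "t \<ge> 0" and s: "\<alpha> (i - 1) * t < s" "s < \<alpha> i * t"
  shows "kernel n \<alpha> K t s = K i t s"
proof -
  have "\<alpha> i * t \<le> 1 * t" using \<alpha>_bounds[of i] i t by (intro mult_right_mono) auto
  then have "s \<noteq> t" using s by auto
  moreover have "(THE j. j \<in> {1..n} \<and> \<alpha> (j - 1) * t \<le> s \<and> s < \<alpha> j * t) = i"
  proof (rule the_equality)
    fix j assume j: "j \<in> {1..n} \<and> \<alpha> (j - 1) * t \<le> s \<and> s < \<alpha> j * t"
    have "\<not> j < i"
    proof
      assume "j < i"
      then have "\<alpha> j * t \<le> \<alpha> (i - 1) * t" using i t by (intro mult_right_mono \<alpha>_le) auto
      then show False using j s by linarith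
    qed
    moreover have "\<not> i < j"
    proof
      assume "i < j"
      then have "\<alpha> i * t \<le> \<alpha> (j - 1) * t" using j t by (intro mult_right_mono \<alpha>_le) auto
      then show False using j s by linarith
    qed
    ultimately show "j = i" by simp
  qed (use i s in auto)
  ultimately show ?thesis by (simp add: kernel_def)
qed

lemma row_integrable:
  assumes "i \<in> {1..n}" "t \<in> {0..T}" "continuous_on {0..T} y" "0 \<le> a" "b \<le> t"
  shows "(\<lambda>s. K i t s * y s) integrable_on {a..b}" "(\<lambda>s. K' i t s * y s) integrable_on {a..b}"
  using assms
  by (auto intro!: integrable_continuous_interval continuous_on_mult K_cont_comp continuous_on_const
      continuous_on_id continuous_on_subset[OF assms(3)] simp: kernel_domain_def)

lemma kernel_has_integral:
  assumes t: "t \<in> {0..T}" and y: "continuous_on {0..T} y"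
  shows "((\<lambda>s. kernel n \<alpha> K t s * y s) has_integral
    (\<Sum>i=1..n. integral {\<alpha> (i - 1) * t..\<alpha> i * t} (\<lambda>s. K i t s * y s))) {0..t}"
proof -
  have "((\<lambda>s. kernel n \<alpha> K t s * y s) has_integral
    (\<Sum>i=1..k. integral {\<alpha> (i - 1) * t..\<alpha> i * t} (\<lambda>s. K i t s * y s))) {0..\<alpha> k * t}" if "k \<le> n" for k
    using that
  proof (induction k)
    case 0
    then show ?case by (simp add: \<alpha>_0 has_integral_refl)
  next
    case (Suc k)
    have \<alpha>: "0 \<le> \<alpha> k * t" "\<alpha> k * t \<le> \<alpha> (Suc k) * t" "\<alpha> (Suc k) * t \<le> t"
      using \<alpha>_bounds[of k] \<alpha>_le[of k "Suc k"] ray_mem[OF t \<alpha>_bounds[of "Suc k"]] Suc.prems t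
      by (auto intro: mult_right_mono)
    have "((\<lambda>s. kernel n \<alpha> K t s * y s) has_integral
      (integral {\<alpha> k * t..\<alpha> (Suc k) * t} (\<lambda>s. K (Suc k) t s * y s))) {\<alpha> k * t..\<alpha> (Suc k) * t}"
    proof (rule has_integral_spike_finite)
      show "((\<lambda>s. K (Suc k) t s * y s) has_integral
          integral {\<alpha> k * t..\<alpha> (Suc k) * t} (\<lambda>s. K (Suc k) t s * y s)) {\<alpha> k * t..\<alpha> (Suc k) * t}"
        using Suc.prems t \<alpha> by (intro integrable_integral row_integrable y) auto
      show "finite {\<alpha> k * t, \<alpha> (Suc k) * t}" by simp
      fix s assume "s \<in> {\<alpha> k * t..\<alpha> (Suc k) * t} - {\<alpha> k * t, \<alpha> (Suc k) * t}"
      then show "kernel n \<alpha> K t s * y s = K (Suc k) t s * y s"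
        using kernel_eq[of "Suc k" t s] Suc.prems t by auto
    qed
    from has_integral_combine[OF \<alpha>(1,2) _ this] Suc show ?case by simp
  qed
  from this[of n] show ?thesis by (simp add: \<alpha>_n)
qed

text \<open>The derivative of \<open>t \<mapsto> \<integral>\<^sub>0\<^sup>t K(t,s) s\<^sup>m u(s) ds\<close> is \<open>t\<^sup>m\<close> times the sum of the following two functions:
  the contribution of the moving end points of the pieces, and, after substituting \<open>s = \<sigma> t\<close>, that
  of the \<open>t\<close>-dependence of the kernel. For \<open>m = N\<close>, dividing them by \<open>K\<^sub>n(t,t)\<close> gives \<open>L\<^sub>0 u\<close> and the
  Volterra part; for \<open>u = 1\<close> they describe the effect of the unknown coefficient \<open>x\<^sub>m\<close>.\<close>

definition boundary_part :: "nat \<Rightarrow> (real \<Rightarrow> real) \<Rightarrow> real \<Rightarrow> real" where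
  "boundary_part m u t = (\<Sum>i=1..n. \<alpha> i ^ (1 + m) * K i t (\<alpha> i * t) * u (\<alpha> i * t)
              - \<alpha> (i - 1) ^ (1 + m) * K i t (\<alpha> (i - 1) * t) * u (\<alpha> (i - 1) * t))"

definition memory_part :: "nat \<Rightarrow> (real \<Rightarrow> real) \<Rightarrow> real \<Rightarrow> real" where
  "memory_part m u t = (\<Sum>i=1..n. t * integral {\<alpha> (i - 1)..\<alpha> i} (\<lambda>\<sigma>. K' i t (\<sigma> * t) * \<sigma> ^ m * u (\<sigma> * t)))"

text \<open>Leibniz' rule, applied to every piece as a difference of two integrals that start at 0. Both
  \<open>(\<sigma> t)\<^sup>m\<close> at the end points and \<open>s\<^sup>m = (\<sigma> t)\<^sup>m\<close> under the integral contribute the common factor \<open>t\<^sup>m\<close>.\<close>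
lemma kernel_integral_deriv:
  assumes t: "t \<in> {0..T}" and u: "continuous_on {0..T} u"
  shows "((\<lambda>t. integral {0..t} (\<lambda>s. kernel n \<alpha> K t s * (s ^ m * u s))) has_real_derivative
     t ^ m * (boundary_part m u t + memory_part m u t)) (at t within {0..T})"
proof -
  let ?y = "\<lambda>s. s ^ m * u s"
  have y: "continuous_on {0..T} ?y" by (intro continuous_intros u)
  have idx: "i \<le> n" "i - 1 \<le> n" "\<alpha> (i - 1) \<le> \<alpha> i" if "i \<in> {1..n}" for i
    using that by (auto intro: \<alpha>_le)
  let ?P = "\<lambda>i a t. integral {0..a * t} (\<lambda>s. K i t s * ?y s)"
  let ?P' = "\<lambda>i a t. a * (K i t (a * t) * ?y (a * t)) + integral {0..a * t} (\<lambda>s. K' i t s * ?y s)"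
  have split: "integral {\<alpha> (i - 1) * t..\<alpha> i * t} \<phi> = integral {0..\<alpha> i * t} \<phi> - integral {0..\<alpha> (i - 1) * t} \<phi>"
    if "i \<in> {1..n}" "t \<in> {0..T}" "\<phi> integrable_on {0..\<alpha> i * t}" for i t and \<phi> :: "real \<Rightarrow> real"
    using Henstock_Kurzweil_Integration.integral_combine[where a = 0 and c = "\<alpha> (i - 1) * t" and b = "\<alpha> i * t" and f = \<phi>] that idx[OF that(1)] \<alpha>_bounds[OF idx(2)[OF that(1)]]
      mult_right_mono[OF idx(3)[OF that(1)], of t]
    by auto
  have int: "(\<lambda>s. K i t s * ?y s) integrable_on {0..\<alpha> i * t}" "(\<lambda>s. K' i t s * ?y s) integrable_on {0..\<alpha> i * t}"
    if "i \<in> {1..n}" "t \<in> {0..T}" for i t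
    using ray_mem[OF that(2) \<alpha>_bounds[OF idx(1)[OF that(1)]]] that by (auto intro!: row_integrable y)
  have eq: "(\<Sum>i=1..n. ?P i (\<alpha> i) \<tau> - ?P i (\<alpha> (i - 1)) \<tau>) = integral {0..\<tau>} (\<lambda>s. kernel n \<alpha> K \<tau> s * ?y s)"
    if \<tau>: "\<tau> \<in> {0..T}" for \<tau>
    using integral_unique[OF kernel_has_integral[OF \<tau> y]] split[OF _ \<tau> int(1)[OF _ \<tau>]] by simp
  have "((\<lambda>t. \<Sum>i=1..n. ?P i (\<alpha> i) t - ?P i (\<alpha> (i - 1)) t) has_real_derivative
      (\<Sum>i=1..n. ?P' i (\<alpha> i) t - ?P' i (\<alpha> (i - 1)) t)) (at t within {0..T})"
  proof (intro DERIV_sum DERIV_diff)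
    fix i assume i: "i \<in> {1..n}"
    show "(?P i (\<alpha> i) has_real_derivative ?P' i (\<alpha> i) t) (at t within {0..T})"
      "(?P i (\<alpha> (i - 1)) has_real_derivative ?P' i (\<alpha> (i - 1)) t) (at t within {0..T})"
      using \<alpha>_bounds[OF idx(1)[OF i]] \<alpha>_bounds[OF idx(2)[OF i]]
      by (auto intro!: leibniz_triangle[OF K_cont[OF i] K_deriv[OF i] K'_cont[OF i] y _ _ t])
  qed
  moreover have "(\<Sum>i=1..n. ?P' i (\<alpha> i) t - ?P' i (\<alpha> (i - 1)) t) = t ^ m * (boundary_part m u t + memory_part m u t)"
    unfolding boundary_part_def memory_part_def sum.distrib[symmetric] sum_distrib_left
  proof (intro sum.cong refl)
    fix i assume i: "i \<in> {1..n}"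
    have "integral {0..\<alpha> i * t} (\<lambda>s. K' i t s * ?y s) - integral {0..\<alpha> (i - 1) * t} (\<lambda>s. K' i t s * ?y s)
      = integral {\<alpha> (i - 1) * t..\<alpha> i * t} (\<lambda>s. K' i t s * ?y s)"
      by (rule split[OF i t int(2)[OF i t], symmetric])
    also have "\<dots> = t * integral {\<alpha> (i - 1)..\<alpha> i} (\<lambda>\<sigma>. t ^ m * (K' i t (\<sigma> * t) * \<sigma> ^ m * u (\<sigma> * t)))"
      using t by (subst integral_scale_interval) (simp_all add: power_mult_distrib mult_ac)
    also have "\<dots> = t ^ m * (t * integral {\<alpha> (i - 1)..\<alpha> i} (\<lambda>\<sigma>. K' i t (\<sigma> * t) * \<sigma> ^ m * u (\<sigma> * t)))"
      by simp
    finally show "?P' i (\<alpha> i) t - ?P' i (\<alpha> (i - 1)) t =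
      t ^ m * (\<alpha> i ^ (1 + m) * K i t (\<alpha> i * t) * u (\<alpha> i * t) - \<alpha> (i - 1) ^ (1 + m) * K i t (\<alpha> (i - 1) * t) * u (\<alpha> (i - 1) * t)
       + t * integral {\<alpha> (i - 1)..\<alpha> i} (\<lambda>\<sigma>. K' i t (\<sigma> * t) * \<sigma> ^ m * u (\<sigma> * t)))"
      by (simp add: power_mult_distrib algebra_simps)
  qed
  ultimately show ?thesis
    using has_field_derivative_transform_within[OF _ zero_less_one t eq] by simp
qed

lemma boundary_part_cont:
  assumes u: "continuous_on {0..T} u"
  shows "continuous_on {0..T} (boundary_part m u)"
  unfolding boundary_part_def
proof (intro continuous_on_sum continuous_on_diff continuous_on_mult)
  fix i assume i: "i \<in> {1..n}"
  have *: "\<sigma> * t \<in> {0..T} \<and> (t, \<sigma> * t) \<in> kernel_domain T" if "\<sigma> = \<alpha> i \<or> \<sigma> = \<alpha> (i - 1)" "t \<in> {0..T}" for t \<sigma>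
    using that ray_mem[OF that(2), of \<sigma>] \<alpha>_step[OF i] by auto
  show "continuous_on {0..T} (\<lambda>t. K i t (\<alpha> i * t))" "continuous_on {0..T} (\<lambda>t. K i t (\<alpha> (i - 1) * t))"
    using * by (auto intro!: K_cont_comp[OF i] continuous_intros)
  show "continuous_on {0..T} (\<lambda>t. u (\<alpha> i * t))" "continuous_on {0..T} (\<lambda>t. u (\<alpha> (i - 1) * t))"
    using * by (auto intro!: continuous_on_compose2[OF u] continuous_intros)
qed (intro continuous_on_const)+

lemma memory_integrand_cont:
  assumes i: "i \<in> {1..n}" and u: "continuous_on {0..T} u"
  shows "continuous_on ({0..T} \<times> {\<alpha> (i - 1)..\<alpha> i}) (\<lambda>(t, \<sigma>). K' i t (\<sigma> * t) * \<sigma> ^ m * u (\<sigma> * t))"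
proof -
  have *: "snd p * fst p \<in> {0..T} \<and> (fst p, snd p * fst p) \<in> kernel_domain T"
    if "p \<in> {0..T} \<times> {\<alpha> (i - 1)..\<alpha> i}" for p
    using that ray_mem[of "fst p" "snd p"] \<alpha>_step(4)[OF i] by (auto simp: mem_Times_iff)
  have "continuous_on ({0..T} \<times> {\<alpha> (i - 1)..\<alpha> i}) (\<lambda>p. K' i (fst p) (snd p * fst p) * snd p ^ m * u (snd p * fst p))"
    using * by (intro continuous_on_mult K_cont_comp(2)[OF i] continuous_on_compose2[OF u])
      (auto intro!: continuous_intros)
  then show ?thesis by (simp add: split_beta)
qed

lemma memory_part_cont:
  assumes u: "continuous_on {0..T} u"
  shows "continuous_on {0..T} (memory_part m u)"
  unfolding memory_part_def
proof (intro continuous_on_sum continuous_on_mult continuous_on_id)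
  fix i assume i: "i \<in> {1..n}"
  show "continuous_on {0..T} (\<lambda>t. integral {\<alpha> (i - 1)..\<alpha> i} (\<lambda>\<sigma>. K' i t (\<sigma> * t) * \<sigma> ^ m * u (\<sigma> * t)))"
    using integral_continuous_on_param[of "{0..T}" "\<alpha> (i - 1)" "\<alpha> i", unfolded cbox_interval,
        OF memory_integrand_cont[OF i u]] by simp
qed

lemma memory_integrand_integrable:
  assumes i: "i \<in> {1..n}" and u: "continuous_on {0..T} u" and t: "t \<in> {0..T}"
  shows "(\<lambda>\<sigma>. K' i t (\<sigma> * t) * \<sigma> ^ m * u (\<sigma> * t)) integrable_on {\<alpha> (i - 1)..\<alpha> i}"
proof (rule integrable_continuous_interval)
  have "continuous_on {\<alpha> (i - 1)..\<alpha> i} (\<lambda>\<sigma>. (\<lambda>(t, \<sigma>). K' i t (\<sigma> * t) * \<sigma> ^ m * u (\<sigma> * t)) (t, \<sigma>))"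
    by (rule continuous_on_compose2[OF memory_integrand_cont[OF i u]]) (use t in \<open>auto intro!: continuous_intros\<close>)
  then show "continuous_on {\<alpha> (i - 1)..\<alpha> i} (\<lambda>\<sigma>. K' i t (\<sigma> * t) * \<sigma> ^ m * u (\<sigma> * t))" by simp
qed

lemma boundary_part_diff:
  assumes "t \<in> {0..T}" "\<And>s. s \<in> {0..T} \<Longrightarrow> d s = a s - b s"
  shows "boundary_part m d t = boundary_part m a t - boundary_part m b t"
proof -
  have *: "d (\<alpha> i * t) = a (\<alpha> i * t) - b (\<alpha> i * t)"
    "d (\<alpha> (i - 1) * t) = a (\<alpha> (i - 1) * t) - b (\<alpha> (i - 1) * t)" if "i \<in> {1..n}" for i
    using assms(2) ray_mem[OF assms(1)] \<alpha>_step[OF that] by blast+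
  show ?thesis
    unfolding boundary_part_def sum_subtractf[symmetric]
    by (intro sum.cong refl) (simp only: *, simp add: right_diff_distrib)
qed

lemma memory_part_diff:
  assumes "t \<in> {0..T}" "\<And>s. s \<in> {0..T} \<Longrightarrow> d s = a s - b s"
    and "continuous_on {0..T} a" "continuous_on {0..T} b"
  shows "memory_part m d t = memory_part m a t - memory_part m b t"
  unfolding memory_part_def sum_subtractf[symmetric]
proof (intro sum.cong refl)
  fix i assume i: "i \<in> {1..n}"
  have *: "d (\<sigma> * t) = a (\<sigma> * t) - b (\<sigma> * t)" if "\<sigma> \<in> {\<alpha> (i - 1)..\<alpha> i}" for \<sigma>
    using assms(2) ray_mem[OF assms(1), of \<sigma>] \<alpha>_step(4)[OF i] that by blast
  have "integral {\<alpha> (i - 1)..\<alpha> i} (\<lambda>\<sigma>. K' i t (\<sigma> * t) * \<sigma> ^ m * d (\<sigma> * t))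
    = integral {\<alpha> (i - 1)..\<alpha> i} (\<lambda>\<sigma>. K' i t (\<sigma> * t) * \<sigma> ^ m * a (\<sigma> * t) - K' i t (\<sigma> * t) * \<sigma> ^ m * b (\<sigma> * t))"
    by (intro integral_cong) (simp add: * right_diff_distrib)
  also have "\<dots> = integral {\<alpha> (i - 1)..\<alpha> i} (\<lambda>\<sigma>. K' i t (\<sigma> * t) * \<sigma> ^ m * a (\<sigma> * t))
      - integral {\<alpha> (i - 1)..\<alpha> i} (\<lambda>\<sigma>. K' i t (\<sigma> * t) * \<sigma> ^ m * b (\<sigma> * t))"
    by (intro integral_diff memory_integrand_integrable i assms)
  finally show "t * integral {\<alpha> (i - 1)..\<alpha> i} (\<lambda>\<sigma>. K' i t (\<sigma> * t) * \<sigma> ^ m * d (\<sigma> * t))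
    = t * integral {\<alpha> (i - 1)..\<alpha> i} (\<lambda>\<sigma>. K' i t (\<sigma> * t) * \<sigma> ^ m * a (\<sigma> * t))
      - t * integral {\<alpha> (i - 1)..\<alpha> i} (\<lambda>\<sigma>. K' i t (\<sigma> * t) * \<sigma> ^ m * b (\<sigma> * t))"
    by (simp add: right_diff_distrib)
qed

section \<open>Expansion of the differentiated integrals at 0\<close>

text \<open>The derivative of \<open>t \<mapsto> \<integral>\<^sub>0\<^sup>t K(t,s) s\<^sup>m ds\<close>, stripped of its factor \<open>t\<^sup>m\<close>; see
  \<open>kernel_integral_deriv\<close>.\<close>
definition monomial_factor :: "nat \<Rightarrow> real \<Rightarrow> real" where
  "monomial_factor m t = boundary_part m (\<lambda>_. 1) t + memory_part m (\<lambda>_. 1) t"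

lemma monomial_factor_cont: "continuous_on {0..T} (monomial_factor m)"
  unfolding monomial_factor_def by (intro continuous_on_add boundary_part_cont memory_part_cont continuous_on_const)

lemma monomial_factor_0: "monomial_factor m 0 = char_L n \<alpha> K m"
  by (simp add: monomial_factor_def boundary_part_def memory_part_def char_L_def algebra_simps)

lemma monomial_factor_lim: "(monomial_factor m \<longlongrightarrow> char_L n \<alpha> K m) (at_right 0)"
proof -
  have "(monomial_factor m \<longlongrightarrow> monomial_factor m 0) (at 0 within {0..T})"
    using monomial_factor_cont T_pos by (simp add: continuous_on_def)
  then show ?thesis using T_pos by (simp add: at_within_Icc_at_right monomial_factor_0)
qed

text \<open>Condition B speaks about total derivatives of \<open>K\<^sub>i\<close> on a relatively open part of the triangle.
  Where \<open>s < T\<close>, the segment of the points \<open>(\<tau>, s)\<close> with \<open>s \<le> \<tau> \<le> T\<close> is nondegenerate, and restricting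
  the total derivative to it identifies its value in direction \<open>(1,0)\<close> with \<open>K\<^sub>i'\<close>, which therefore is \<open>N\<close> times
  differentiable near the origin.\<close>
lemma ray_expandable_K:
  assumes "condition_B T n K f N" and i: "i \<in> {1..n}"
  shows "ray_expandable N (K i)" "ray_expandable N (K' i)"
proof -
  obtain U where U: "open U" "(0, 0) \<in> U"
    and "times_differentiable_on (N + 1) (\<lambda>(t, s). K i t s) (U \<inter> kernel_domain T)"
    using assms unfolding condition_B_def by blast
  then have td: "times_differentiable_on (Suc N) (\<lambda>(t, s). K i t s) (U \<inter> kernel_domain T)"
    by (simp only: Suc_eq_plus1)
  let ?S = "U \<inter> kernel_domain T"
  have S0: "0 \<in> ?S" using U T_pos by (simp add: kernel_domain_def zero_prod_def)
  have at0: "continuous (at 0 within ?S) k" if "continuous_on (kernel_domain T) k" for k :: "real \<times> real \<Rightarrow> real"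
  proof (rule continuous_within_subset[of 0 "kernel_domain T"])
    show "continuous (at 0 within kernel_domain T) k"
      using that S0 unfolding continuous_on_eq_continuous_within by blast
  qed simp
  show "ray_expandable N (K i)"
    by (rule ray_expandable_times_differentiable[OF T_pos U times_differentiable_on_SucD[OF td] at0[OF K_cont[OF i]]])
       simp
  obtain F where F: "\<And>p. p \<in> ?S \<Longrightarrow> ((\<lambda>(t, s). K i t s) has_derivative F p) (at p within ?S)"
    and tdF: "\<And>e. times_differentiable_on N (\<lambda>p. F p e) ?S"
    using td unfolding times_differentiable_on.simps by blast
  have eq: "F (t, s) (1, 0) = K' i t s" if ts: "(t, s) \<in> ?S" and s: "s < T" for t s
  proof -
    interpret bounded_linear "F (t, s)" using F[OF ts] by (rule has_derivative_bounded_linear)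
    define W where "W = (\<lambda>\<tau>. (\<tau>, s)) -` U"
    have W: "open W" unfolding W_def by (intro open_vimage U continuous_intros)
    have t: "t \<in> {s..T}" "t \<in> W" using ts by (auto simp: kernel_domain_def W_def)
    have inner: "((\<lambda>\<tau>. (\<tau>, s)) has_derivative (\<lambda>h. (h, 0))) (at t within W \<inter> {s..T})"
      by (auto intro!: derivative_eq_intros)
    have "(\<lambda>\<tau>. (\<tau>, s)) ` (W \<inter> {s..T}) \<subseteq> ?S"
      using ts by (auto simp: kernel_domain_def W_def)
    from has_derivative_in_compose[OF inner has_derivative_subset[OF F[OF ts] this]]
    have "((\<lambda>\<tau>. K i \<tau> s) has_derivative (\<lambda>h. F (t, s) (h, 0))) (at t within W \<inter> {s..T})"
      by simp
    moreover have "at t within W \<inter> {s..T} = at t within {s..T}"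
      using t W by (intro at_within_nhd[of _ W]) auto
    ultimately have "((\<lambda>\<tau>. K i \<tau> s) has_derivative (\<lambda>h. F (t, s) (h, 0))) (at t within {s..T})"
      by simp
    moreover have "(\<lambda>h. F (t, s) (h, 0)) = (\<lambda>h. h *\<^sub>R F (t, s) (1, 0))"
    proof
      show "F (t, s) (h, 0) = h *\<^sub>R F (t, s) (1, 0)" for h using scaleR[of h "(1, 0)"] by simp
    qed
    ultimately have 1: "((\<lambda>\<tau>. K i \<tau> s) has_vector_derivative F (t, s) (1, 0)) (at t within {s..T})"
      unfolding has_vector_derivative_def by (rule has_derivative_eq_rhs)
    have 2: "((\<lambda>\<tau>. K i \<tau> s) has_vector_derivative K' i t s) (at t within {s..T})"
      using K_deriv[OF i, of t s] ts by (simp add: has_real_derivative_iff_has_vector_derivative)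
    show ?thesis
      using t by (intro vector_derivative_unique_within_closed_interval[unfolded cbox_interval, OF s _ 1 2]) simp
  qed
  have "continuous (at 0 within ?S) (\<lambda>p. F p (1, 0))"
  proof (rule continuous_transform_within[OF at0[OF K'_cont[OF i]] T_pos S0])
    fix p assume p: "p \<in> ?S" "dist p 0 < T"
    have "snd p \<le> fst p" "fst p < T"
      using p norm_fst_le[of "fst p" "snd p"] by (auto simp: kernel_domain_def)
    then show "(case p of (t, s) \<Rightarrow> K' i t s) = F p (1, 0)"
      using eq[of "fst p" "snd p"] p(1) by (simp add: split_beta)
  qed
  from ray_expandable_times_differentiable[OF T_pos U tdF this]
  show "ray_expandable N (K' i)" using eq by (auto simp: kernel_domain_def)
qed

lemma monomial_factor_taylor:
  assumes B: "condition_B T n K f N"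
  shows "taylor_approx N (monomial_factor m)"
proof -
  have term_i: "taylor_approx N (\<lambda>t. (\<alpha> i ^ (1 + m) * K i t (\<alpha> i * t) * 1
      - \<alpha> (i - 1) ^ (1 + m) * K i t (\<alpha> (i - 1) * t) * 1)
      + t * integral {\<alpha> (i - 1)..\<alpha> i} (\<lambda>\<sigma>. K' i t (\<sigma> * t) * \<sigma> ^ m * 1))" if i: "i \<in> {1..n}" for i
  proof -
    have b: "taylor_approx N (\<lambda>t. poly [:c:] t * K i t (\<alpha> j * t))" if "j = i \<or> j = i - 1" for c j
      using that \<alpha>_step[OF i]
      by (intro taylor_approx_poly_mult ray_expandable_fixed ray_expandable_K(1)[OF B i]) auto
    have c: "taylor_approx N (\<lambda>t. poly [:0, 1:] t * integral {\<alpha> (i - 1)..\<alpha> i} (\<lambda>\<sigma>. K' i t (\<sigma> * t) * \<sigma> ^ m))"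
    proof (intro taylor_approx_poly_mult ray_expandable_integral[OF ray_expandable_K(2)[OF B i] _ _ _ T_pos])
      show "(\<lambda>\<sigma>. K' i t (\<sigma> * t) * \<sigma> ^ m) integrable_on {\<alpha> (i - 1)..\<alpha> i}" if "t \<in> {0..T}" for t
        using memory_integrand_integrable[OF i continuous_on_const that, of m 1] by simp
    qed (use \<alpha>_step[OF i] in auto)
    show ?thesis
      using taylor_approx_add[OF taylor_approx_add[OF b[of i "\<alpha> i ^ (1 + m)"] b[of "i - 1" "- (\<alpha> (i - 1) ^ (1 + m))"]] c]
      by simp
  qed
  from taylor_approx_sum[OF _ this, of "{1..n}" "\<lambda>i. i"]
  show ?thesis
    unfolding monomial_factor_def boundary_part_def memory_part_def sum.distrib[symmetric] by simp
qed

end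

section \<open>The functional operator and the Volterra operator\<close>

locale dominant_kernel = piecewise_kernel +
  fixes N :: nat
  assumes cond_A: "condition_A T n \<alpha> K N"
begin

abbreviation "L0 \<equiv> op_L0 T n \<alpha> K N"
abbreviation "V \<equiv> op_V T n \<alpha> K K' N"

lemma diag_nz: "t \<in> {0..T} \<Longrightarrow> K n t t \<noteq> 0"
  using cond_A by (simp add: condition_A_def)

lemma diag_cont: "continuous_on {0..T} (\<lambda>t. K n t t)"
  using n_pos by (intro K_cont_comp continuous_on_id) (auto simp: kernel_domain_def)

lemma L0_apply: "t \<in> {0..T} \<Longrightarrow> L0 u t = boundary_part N u t / K n t t"
  by (simp add: op_L0_def boundary_part_def)

lemma V_apply: "t \<in> {0..T} \<Longrightarrow> V u t = memory_part N u t / K n t t"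
  by (simp add: op_V_apply memory_part_def)

lemma L0_maps: "u \<in> C_space T \<Longrightarrow> L0 u \<in> C_space T"
proof -
  assume "u \<in> C_space T"
  then have "continuous_on {0..T} (\<lambda>t. boundary_part N u t / K n t t)"
    by (intro continuous_on_divide boundary_part_cont diag_cont) (auto simp: diag_nz C_space_def)
  moreover have "L0 u = (\<lambda>t\<in>{0..T}. boundary_part N u t / K n t t)"
    by (auto simp: op_L0_def boundary_part_def)
  ultimately show ?thesis by (simp only: C_spaceI)
qed

lemma V_maps: "u \<in> C_space T \<Longrightarrow> V u \<in> C_space T"
proof -
  assume "u \<in> C_space T"
  then have "continuous_on {0..T} (\<lambda>t. memory_part N u t / K n t t)"
    by (intro continuous_on_divide memory_part_cont diag_cont) (auto simp: diag_nz C_space_def)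
  moreover have "V u = (\<lambda>t\<in>{0..T}. memory_part N u t / K n t t)"
  proof (rule extensionalityI)
    show "V u \<in> extensional {0..T}" by (simp add: op_V_def)
  qed (simp_all add: V_apply)
  ultimately show ?thesis by (simp only: C_spaceI)
qed

lemma L0_diff:
  assumes "t \<in> {0..T}" "\<And>s. s \<in> {0..T} \<Longrightarrow> d s = a s - b s"
  shows "L0 d t = L0 a t - L0 b t"
  using assms boundary_part_diff[OF assms] by (simp add: L0_apply diff_divide_distrib)

lemma V_diff:
  assumes "t \<in> {0..T}" "\<And>s. s \<in> {0..T} \<Longrightarrow> d s = a s - b s" "a \<in> C_space T" "b \<in> C_space T"
  shows "V d t = V a t - V b t"
  using assms memory_part_diff[OF assms(1,2)] by (simp add: V_apply diff_divide_distrib C_space_def)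

text \<open>The supremum in Condition A is that of a continuous function on a compact interval, hence
  bounds each of its values. Replacing \<open>q\<close> by \<open>max q 0\<close> loses nothing.\<close>
lemma dominance:
  obtains q where "0 \<le> q" "q < 1"
    "\<And>t. t \<in> {0..T} \<Longrightarrow> (\<Sum>i=1..n. \<alpha> i ^ (1 + N) * \<bar>K i t (\<alpha> i * t)\<bar>
        + \<alpha> (i - 1) ^ (1 + N) * \<bar>K i t (\<alpha> (i - 1) * t)\<bar>) \<le> (1 + q) * \<bar>K n t t\<bar>"
proof -
  let ?S = "\<lambda>t. \<Sum>i=1..n. \<alpha> i ^ (1 + N) * \<bar>K i t (\<alpha> i * t)\<bar>
        + \<alpha> (i - 1) ^ (1 + N) * \<bar>K i t (\<alpha> (i - 1) * t)\<bar>"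
  obtain q where q: "q < 1" "(SUP t\<in>{0..T}. inverse \<bar>K n t t\<bar> * ?S t) \<le> 1 + q"
    using cond_A by (auto simp: condition_A_def)
  have "continuous_on {0..T} (\<lambda>t. inverse \<bar>K n t t\<bar> * ?S t)"
  proof (intro continuous_on_mult continuous_on_inverse continuous_on_sum continuous_on_add
      continuous_on_rabs diag_cont continuous_on_const)
    fix i assume i: "i \<in> {1..n}"
    have *: "(t, \<sigma> * t) \<in> kernel_domain T" if "\<sigma> = \<alpha> i \<or> \<sigma> = \<alpha> (i - 1)" "t \<in> {0..T}" for t \<sigma>
      using that ray_mem[OF that(2), of \<sigma>] \<alpha>_step[OF i] by auto
    show "continuous_on {0..T} (\<lambda>t. K i t (\<alpha> i * t))" "continuous_on {0..T} (\<lambda>t. K i t (\<alpha> (i - 1) * t))"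
      using * by (auto intro!: K_cont_comp[OF i] continuous_intros)
  qed (simp add: diag_nz)
  then have "compact ((\<lambda>t. inverse \<bar>K n t t\<bar> * ?S t) ` {0..T})"
    by (intro compact_continuous_image compact_Icc)
  then have bdd: "bdd_above ((\<lambda>t. inverse \<bar>K n t t\<bar> * ?S t) ` {0..T})"
    by (intro bounded_imp_bdd_above compact_imp_bounded)
  have le: "?S t \<le> (1 + q) * \<bar>K n t t\<bar>" if t: "t \<in> {0..T}" for t
  proof -
    have "inverse \<bar>K n t t\<bar> * ?S t \<le> 1 + q"
      using cSUP_upper[OF t bdd] q(2) by linarith
    then show ?thesis using diag_nz[OF t] by (simp add: field_simps)
  qed
  show ?thesis
  proof (rule that[of "max q 0"])
    fix t assume t: "t \<in> {0..T}"
    show "?S t \<le> (1 + max q 0) * \<bar>K n t t\<bar>"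
      using le[OF t] mult_right_mono[of "1 + q" "1 + max q 0" "\<bar>K n t t\<bar>"] by linarith
  qed (use q in auto)
qed

text \<open>Since \<open>\<alpha>\<^sub>n = 1\<close>, the term of \<open>L\<^sub>0 a\<close> with \<open>\<alpha>\<^sub>n\<close> is \<open>a\<close> itself. In the sum of Condition A this term
  contributes exactly 1, so the absolute values of all other weights add up to at most \<open>q\<close>. The
  bound survives exponential weights because the other terms evaluate \<open>a\<close> at arguments \<open>\<alpha>\<^sub>i t \<le> t\<close>.\<close>
lemma L0_near_identity:
  obtains q where "0 \<le> q" "q < 1"
    "\<And>a B \<kappa> t. \<lbrakk>0 \<le> \<kappa>; \<And>s. s \<in> {0..T} \<Longrightarrow> \<bar>a s\<bar> \<le> B * exp (\<kappa> * s); t \<in> {0..T}\<rbrakk>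
      \<Longrightarrow> \<bar>L0 a t - a t\<bar> \<le> q * B * exp (\<kappa> * t)"
proof -
  obtain q where q: "0 \<le> q" "q < 1" and dom:
    "\<And>t. t \<in> {0..T} \<Longrightarrow> (\<Sum>i=1..n. \<alpha> i ^ (1 + N) * \<bar>K i t (\<alpha> i * t)\<bar>
        + \<alpha> (i - 1) ^ (1 + N) * \<bar>K i t (\<alpha> (i - 1) * t)\<bar>) \<le> (1 + q) * \<bar>K n t t\<bar>"
    using dominance by blast
  show ?thesis
  proof (rule that[OF q])
    fix a :: "real \<Rightarrow> real" and B \<kappa> t :: real
    assume \<kappa>: "0 \<le> \<kappa>" and a: "\<And>s. s \<in> {0..T} \<Longrightarrow> \<bar>a s\<bar> \<le> B * exp (\<kappa> * s)" and t: "t \<in> {0..T}"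
    define X where "X = B * exp (\<kappa> * t)"
    have B: "B \<ge> 0" using a[of 0] T_pos by auto
    have aX: "\<bar>a (\<sigma> * t)\<bar> \<le> X" if "\<sigma> \<in> {0..1}" for \<sigma>
    proof -
      have "\<bar>a (\<sigma> * t)\<bar> \<le> B * exp (\<kappa> * (\<sigma> * t))" using ray_mem[OF t that] by (intro a) blast
      also have "\<dots> \<le> X"
        unfolding X_def using ray_mem[OF t that] \<kappa> B by (intro mult_left_mono) (auto intro: mult_left_mono)
      finally show ?thesis .
    qed
    define p where "p i = \<alpha> i ^ (1 + N) * K i t (\<alpha> i * t)" for i
    define r where "r i = \<alpha> (i - 1) ^ (1 + N) * K i t (\<alpha> (i - 1) * t)" for i
    have abs_pr: "\<bar>p i\<bar> = \<alpha> i ^ (1 + N) * \<bar>K i t (\<alpha> i * t)\<bar>"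
      "\<bar>r i\<bar> = \<alpha> (i - 1) ^ (1 + N) * \<bar>K i t (\<alpha> (i - 1) * t)\<bar>" if "i \<in> {1..n}" for i
      using \<alpha>_step[OF that] by (auto simp: p_def r_def abs_mult)
    have n: "n \<in> {1..n}" using n_pos by simp
    have pn: "p n = K n t t" by (simp add: p_def \<alpha>_n)
    have "boundary_part N a t = (\<Sum>i=1..n. p i * a (\<alpha> i * t)) - (\<Sum>i=1..n. r i * a (\<alpha> (i - 1) * t))"
      by (simp add: boundary_part_def p_def r_def sum_subtractf)
    also have "(\<Sum>i=1..n. p i * a (\<alpha> i * t)) = K n t t * a t + (\<Sum>i\<in>{1..n}-{n}. p i * a (\<alpha> i * t))"
      using sum.remove[OF _ n, of "\<lambda>i. p i * a (\<alpha> i * t)"] by (simp add: pn \<alpha>_n)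
    finally have "\<bar>boundary_part N a t - K n t t * a t\<bar>
      = \<bar>(\<Sum>i\<in>{1..n}-{n}. p i * a (\<alpha> i * t)) - (\<Sum>i=1..n. r i * a (\<alpha> (i - 1) * t))\<bar>"
      by simp
    also have "\<dots> \<le> (\<Sum>i\<in>{1..n}-{n}. \<bar>p i * a (\<alpha> i * t)\<bar>) + (\<Sum>i=1..n. \<bar>r i * a (\<alpha> (i - 1) * t)\<bar>)"
      by (intro order.trans[OF abs_triangle_ineq4] add_mono sum_abs)
    also have "\<dots> \<le> (\<Sum>i\<in>{1..n}-{n}. \<bar>p i\<bar> * X) + (\<Sum>i=1..n. \<bar>r i\<bar> * X)"
    proof (intro add_mono sum_mono)
      show "\<bar>p i * a (\<alpha> i * t)\<bar> \<le> \<bar>p i\<bar> * X" if "i \<in> {1..n} - {n}" for i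
        unfolding abs_mult using that \<alpha>_step(1)[of i] by (intro mult_left_mono aX) auto
      show "\<bar>r i * a (\<alpha> (i - 1) * t)\<bar> \<le> \<bar>r i\<bar> * X" if "i \<in> {1..n}" for i
        unfolding abs_mult using \<alpha>_step(2)[OF that] by (intro mult_left_mono aX) auto
    qed
    also have "\<dots> = ((\<Sum>i=1..n. \<bar>p i\<bar> + \<bar>r i\<bar>) - \<bar>K n t t\<bar>) * X"
    proof -
      have "(\<Sum>i\<in>{1..n}-{n}. \<bar>p i\<bar>) = (\<Sum>i=1..n. \<bar>p i\<bar>) - \<bar>K n t t\<bar>"
        using sum.remove[OF _ n, of "\<lambda>i. \<bar>p i\<bar>"] by (simp add: pn)
      then show ?thesis
        unfolding sum_distrib_right[symmetric] sum.distrib by (simp only:) (simp add: algebra_simps)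
    qed
    also have "(\<Sum>i=1..n. \<bar>p i\<bar> + \<bar>r i\<bar>) - \<bar>K n t t\<bar> \<le> q * \<bar>K n t t\<bar>"
      using dom[OF t] by (simp add: abs_pr algebra_simps)
    finally have *: "\<bar>boundary_part N a t - K n t t * a t\<bar> \<le> q * \<bar>K n t t\<bar> * X"
      using B by (simp add: X_def mult_right_mono)
    have "L0 a t - a t = (boundary_part N a t - K n t t * a t) / K n t t"
      using t diag_nz[OF t] by (simp add: L0_apply diff_divide_distrib)
    then have "\<bar>L0 a t - a t\<bar> = \<bar>boundary_part N a t - K n t t * a t\<bar> / \<bar>K n t t\<bar>"
      by (simp add: abs_divide)
    also have "\<dots> \<le> q * \<bar>K n t t\<bar> * X / \<bar>K n t t\<bar>" by (intro divide_right_mono *) simp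
    finally show "\<bar>L0 a t - a t\<bar> \<le> q * B * exp (\<kappa> * t)"
      using diag_nz[OF t] by (simp add: X_def)
  qed
qed

text \<open>Evaluating the previous estimate where \<open>\<bar>u(t)\<bar> exp (- \<kappa> t)\<close> is maximal bounds the inverse of
  \<open>L\<^sub>0\<close> by \<open>1 / (1 - q)\<close> in every weighted norm, uniformly in the weight.\<close>
lemma L0_coercive:
  obtains c where "0 < c"
    "\<And>u B \<kappa> t. \<lbrakk>u \<in> C_space T; 0 \<le> \<kappa>; \<And>s. s \<in> {0..T} \<Longrightarrow> \<bar>L0 u s\<bar> \<le> B * exp (\<kappa> * s); t \<in> {0..T}\<rbrakk>
      \<Longrightarrow> \<bar>u t\<bar> \<le> c * B * exp (\<kappa> * t)"
proof -
  obtain q where q: "0 \<le> q" "q < 1" and near: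
    "\<And>a B \<kappa> t. \<lbrakk>0 \<le> \<kappa>; \<And>s. s \<in> {0..T} \<Longrightarrow> \<bar>a s\<bar> \<le> B * exp (\<kappa> * s); t \<in> {0..T}\<rbrakk>
      \<Longrightarrow> \<bar>L0 a t - a t\<bar> \<le> q * B * exp (\<kappa> * t)"
    using L0_near_identity by blast
  show ?thesis
  proof (rule that[of "1 / (1 - q)"])
    fix u and B \<kappa> t :: real
    assume u: "u \<in> C_space T" and \<kappa>: "0 \<le> \<kappa>"
      and L: "\<And>s. s \<in> {0..T} \<Longrightarrow> \<bar>L0 u s\<bar> \<le> B * exp (\<kappa> * s)" and t: "t \<in> {0..T}"
    have "continuous_on {0..T} (\<lambda>s. \<bar>u s\<bar> * exp (- (\<kappa> * s)))"
      using u by (intro continuous_intros) (simp add: C_space_def)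
    then obtain s where s: "s \<in> {0..T}"
      and max: "\<And>r. r \<in> {0..T} \<Longrightarrow> \<bar>u r\<bar> * exp (- (\<kappa> * r)) \<le> \<bar>u s\<bar> * exp (- (\<kappa> * s))"
      using continuous_attains_sup[of "{0..T}" "\<lambda>s. \<bar>u s\<bar> * exp (- (\<kappa> * s))"] T_pos by auto
    define S where "S = \<bar>u s\<bar> * exp (- (\<kappa> * s))"
    have us: "\<bar>u s\<bar> = S * exp (\<kappa> * s)" by (simp add: S_def exp_minus)
    have uS: "\<bar>u r\<bar> \<le> S * exp (\<kappa> * r)" if "r \<in> {0..T}" for r
    proof -
      have "\<bar>u r\<bar> = \<bar>u r\<bar> * exp (- (\<kappa> * r)) * exp (\<kappa> * r)" by (simp add: exp_minus)
      also have "\<dots> \<le> S * exp (\<kappa> * r)" unfolding S_def by (intro mult_right_mono max that) simp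
      finally show ?thesis .
    qed
    have "\<bar>L0 u s - u s\<bar> \<le> q * S * exp (\<kappa> * s)" by (rule near[OF \<kappa> uS s])
    then have "S * exp (\<kappa> * s) \<le> B * exp (\<kappa> * s) + q * S * exp (\<kappa> * s)"
      using L[OF s] us by linarith
    then have "S * exp (\<kappa> * s) \<le> (B + q * S) * exp (\<kappa> * s)" by (simp add: algebra_simps)
    then have "S \<le> B + q * S" by simp
    then have "S \<le> 1 / (1 - q) * B" using q by (simp add: field_simps)
    then have "S * exp (\<kappa> * t) \<le> 1 / (1 - q) * B * exp (\<kappa> * t)" by (intro mult_right_mono) auto
    then show "\<bar>u t\<bar> \<le> 1 / (1 - q) * B * exp (\<kappa> * t)" using uS[OF t] by linarith
  qed (use q in simp)
qed

text \<open>Solving \<open>L\<^sub>0 u = v\<close> amounts to finding the fixed point of \<open>u \<mapsto> v - (L\<^sub>0 u - u)\<close>.\<close>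
lemma L0_bij: "bij_betw L0 (C_space T) (C_space T)"
proof -
  obtain q where q: "0 \<le> q" "q < 1" and near:
    "\<And>a B \<kappa> t. \<lbrakk>0 \<le> \<kappa>; \<And>s. s \<in> {0..T} \<Longrightarrow> \<bar>a s\<bar> \<le> B * exp (\<kappa> * s); t \<in> {0..T}\<rbrakk>
      \<Longrightarrow> \<bar>L0 a t - a t\<bar> \<le> q * B * exp (\<kappa> * t)"
    using L0_near_identity by blast
  have "\<exists>!u. u \<in> C_space T \<and> L0 u = v" if v: "v \<in> C_space T" for v
  proof -
    let ?\<Phi> = "\<lambda>u. \<lambda>t\<in>{0..T}. v t - (L0 u t - u t)"
    have maps: "?\<Phi> u \<in> C_space T" if "u \<in> C_space T" for u
      using v that L0_maps[OF that] unfolding C_space_def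
      by (intro C_spaceI[unfolded C_space_def] continuous_on_diff) simp_all
    have fp: "?\<Phi> u = u \<longleftrightarrow> L0 u = v" if u: "u \<in> C_space T" for u
    proof
      assume *: "?\<Phi> u = u"
      show "L0 u = v"
      proof (rule C_space_eqI[OF L0_maps[OF u] v])
        fix t assume "t \<in> {0..T}"
        then show "L0 u t = v t" using fun_cong[OF *, of t] by simp
      qed
    next
      assume *: "L0 u = v"
      show "?\<Phi> u = u" by (rule C_space_eqI[OF maps[OF u] u]) (simp add: *)
    qed
    have contr: "\<bar>?\<Phi> a t - ?\<Phi> b t\<bar> \<le> q * B * exp (0 * t)"
      if "\<And>t. t \<in> {0..T} \<Longrightarrow> \<bar>a t - b t\<bar> \<le> B * exp (0 * t)" "t \<in> {0..T}" for a b B t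
    proof -
      have "\<bar>L0 (\<lambda>s. a s - b s) t - (a t - b t)\<bar> \<le> q * B * exp (0 * t)"
        by (rule near[OF order.refl that])
      moreover have "?\<Phi> a t - ?\<Phi> b t = - (L0 (\<lambda>s. a s - b s) t - (a t - b t))"
        using L0_diff[of t "\<lambda>s. a s - b s" a b, OF that(2) refl] that(2) by simp
      ultimately show ?thesis by (simp only: abs_minus_cancel)
    qed
    show ?thesis
    proof (rule C_space_fixed_point[of T 0 q ?\<Phi>])
      fix u assume u: "u \<in> C_space T" "?\<Phi> u = u" and uniq: "\<And>w. w \<in> C_space T \<Longrightarrow> ?\<Phi> w = w \<Longrightarrow> w = u"
      show "\<exists>!u. u \<in> C_space T \<and> L0 u = v"
      proof (rule ex1I[of _ u])
        show "u \<in> C_space T \<and> L0 u = v" by (intro conjI u(1) fp[THEN iffD1] u(2))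
        show "w = u" if "w \<in> C_space T \<and> L0 w = v" for w
        proof (rule uniq)
          show "w \<in> C_space T" using that by (rule conjunct1)
          then show "?\<Phi> w = w" using that by (intro fp[THEN iffD2] conjunct2[OF that])
        qed
      qed
    next
      fix a b B t
      assume ab: "\<And>t. t \<in> {0..T} \<Longrightarrow> \<bar>a t - b t\<bar> \<le> B * exp (0 * t)" and t: "t \<in> {0..T}"
      show "\<bar>?\<Phi> a t - ?\<Phi> b t\<bar> \<le> q * B * exp (0 * t)" by (rule contr[of a b B t, OF ab t])
    next
      fix u assume "u \<in> C_space T"
      then show "?\<Phi> u \<in> C_space T" by (rule maps)
    qed (use T_pos q in linarith)+
  qed
  note * = this
  show ?thesis
  proof (rule bij_betwI')
    show "(L0 x = L0 y) = (x = y)" if "x \<in> C_space T" "y \<in> C_space T" for x y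
      using *[OF L0_maps[OF that(1)]] that by metis
    show "\<exists>x\<in>C_space T. y = L0 x" if "y \<in> C_space T" for y
      using ex1_implies_ex[OF *[OF that]] by blast
  qed (rule L0_maps)
qed

text \<open>Integrating \<open>exp (\<kappa> s)\<close> gains the factor \<open>1 / \<kappa>\<close>, so the Volterra part is arbitrarily small in
  the weighted norms with large weight.\<close>
lemma V_bound:
  obtains M where "0 \<le> M"
    "\<And>u B \<kappa> t. \<lbrakk>u \<in> C_space T; 0 < \<kappa>; \<And>s. s \<in> {0..T} \<Longrightarrow> \<bar>u s\<bar> \<le> B * exp (\<kappa> * s); t \<in> {0..T}\<rbrakk>
      \<Longrightarrow> \<bar>V u t\<bar> \<le> M / \<kappa> * B * exp (\<kappa> * t)"
proof -
  have "\<exists>C. \<forall>p\<in>{0..T} \<times> {0..1}. \<bar>K' i (fst p) (snd p * fst p) / K n (fst p) (fst p)\<bar> \<le> C" if i: "i \<in> {1..n}" for i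
  proof -
    have "continuous_on ({0..T} \<times> {0..1}) (\<lambda>p. K' i (fst p) (snd p * fst p) / K n (fst p) (fst p))"
    proof (intro continuous_on_divide)
      show "continuous_on ({0..T} \<times> {0..1}) (\<lambda>p. K' i (fst p) (snd p * fst p))"
        using ray_mem by (intro K_cont_comp[OF i]) (auto intro!: continuous_intros simp: mem_Times_iff)
      show "continuous_on ({0..T} \<times> {0..1}) (\<lambda>p::real\<times>real. K n (fst p) (fst p))"
        by (rule continuous_on_compose2[OF diag_cont]) (auto intro!: continuous_intros)
    qed (auto simp: diag_nz)
    then have "bounded ((\<lambda>p. K' i (fst p) (snd p * fst p) / K n (fst p) (fst p)) ` ({0..T} \<times> {0..1}))"
      by (intro compact_imp_bounded compact_continuous_image compact_Times compact_Icc)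
    then show ?thesis unfolding bounded_iff by simp
  qed
  then obtain C where C: "\<And>i t \<sigma>. \<lbrakk>i \<in> {1..n}; t \<in> {0..T}; \<sigma> \<in> {0..1}\<rbrakk> \<Longrightarrow> \<bar>K' i t (\<sigma> * t) / K n t t\<bar> \<le> C i"
    by (metis fst_conv mem_Times_iff snd_conv)
  have C0: "C i \<ge> 0" if "i \<in> {1..n}" for i 
    by (rule order.trans[OF abs_ge_zero C[OF that, of 0 0]]) (use T_pos in auto)
  show ?thesis
  proof (rule that[of "\<Sum>i=1..n. C i"])
    show "0 \<le> (\<Sum>i=1..n. C i)" by (intro sum_nonneg C0)
    fix u and B \<kappa> t :: real
    assume u: "u \<in> C_space T" and \<kappa>: "0 < \<kappa>"
      and uB: "\<And>s. s \<in> {0..T} \<Longrightarrow> \<bar>u s\<bar> \<le> B * exp (\<kappa> * s)" and t: "t \<in> {0..T}"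
    have uc: "continuous_on {0..T} u" using u by (simp add: C_space_def)
    have B: "B \<ge> 0" using uB[of 0] T_pos by auto
    have "\<bar>t * integral {\<alpha> (i - 1)..\<alpha> i} (\<lambda>\<sigma>. K' i t (\<sigma> * t) * \<sigma> ^ N * u (\<sigma> * t)) / K n t t\<bar>
        \<le> C i * (1 / \<kappa> * B * exp (\<kappa> * t))" if i: "i \<in> {1..n}" for i
    proof -
      let ?I = "{\<alpha> (i - 1)..\<alpha> i}"
      have "((\<lambda>\<sigma>. C i * B / \<kappa> * exp (\<kappa> * t * \<sigma>)) has_vector_derivative
          t * (C i * B * exp (\<kappa> * (\<sigma> * t)))) (at \<sigma> within ?I)" for \<sigma>
        unfolding has_real_derivative_iff_has_vector_derivative[symmetric]
        using \<kappa> by (auto intro!: derivative_eq_intros simp: field_simps)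
      then have int: "((\<lambda>\<sigma>. t * (C i * B * exp (\<kappa> * (\<sigma> * t)))) has_integral
          C i * B / \<kappa> * exp (\<kappa> * t * \<alpha> i) - C i * B / \<kappa> * exp (\<kappa> * t * \<alpha> (i - 1))) ?I"
        by (intro fundamental_theorem_of_calculus \<alpha>_step(3)[OF i])
      have "t * integral ?I (\<lambda>\<sigma>. K' i t (\<sigma> * t) * \<sigma> ^ N * u (\<sigma> * t)) / K n t t
        = integral ?I (\<lambda>\<sigma>. t * (K' i t (\<sigma> * t) * \<sigma> ^ N * u (\<sigma> * t)) / K n t t)"
        by simp
      also have "norm \<dots> \<le> integral ?I (\<lambda>\<sigma>. t * (C i * B * exp (\<kappa> * (\<sigma> * t))))"
      proof (rule integral_norm_bound_integral)
        show "(\<lambda>\<sigma>. t * (K' i t (\<sigma> * t) * \<sigma> ^ N * u (\<sigma> * t)) / K n t t) integrable_on ?I"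
          by (intro integrable_on_divide integrable_on_mult_right memory_integrand_integrable[OF i uc t])
        show "(\<lambda>\<sigma>. t * (C i * B * exp (\<kappa> * (\<sigma> * t)))) integrable_on ?I" using int by blast
        fix \<sigma> assume "\<sigma> \<in> ?I"
        then have \<sigma>: "\<sigma> \<in> {0..1}" using \<alpha>_step(4)[OF i] by blast
        have "norm (t * (K' i t (\<sigma> * t) * \<sigma> ^ N * u (\<sigma> * t)) / K n t t)
          = t * (\<bar>K' i t (\<sigma> * t) / K n t t\<bar> * (\<sigma> ^ N * \<bar>u (\<sigma> * t)\<bar>))"
          using t \<sigma> by (simp add: abs_mult)
        also have "\<dots> \<le> t * (C i * (1 * (B * exp (\<kappa> * (\<sigma> * t)))))"
          using t \<sigma> C[OF i t \<sigma>] C0[OF i] uB ray_mem[OF t \<sigma>]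
          by (intro mult_left_mono mult_mono power_le_one) auto
        finally show "norm (t * (K' i t (\<sigma> * t) * \<sigma> ^ N * u (\<sigma> * t)) / K n t t) \<le> t * (C i * B * exp (\<kappa> * (\<sigma> * t)))"
          by (simp add: mult.assoc)
      qed
      also have "\<dots> \<le> C i * B / \<kappa> * exp (\<kappa> * t * \<alpha> i)"
        using C0[OF i] B \<kappa> by (subst integral_unique[OF int]) simp
      also have "\<dots> \<le> C i * B / \<kappa> * exp (\<kappa> * t * 1)"
        using C0[OF i] B \<kappa> t \<alpha>_step(1)[OF i]
        by (intro mult_left_mono iffD2[OF exp_le_cancel_iff]) auto
      finally show ?thesis by simp
    qed
    then have "(\<Sum>i=1..n. \<bar>t * integral {\<alpha> (i - 1)..\<alpha> i} (\<lambda>\<sigma>. K' i t (\<sigma> * t) * \<sigma> ^ N * u (\<sigma> * t)) / K n t t\<bar>)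
        \<le> (\<Sum>i=1..n. C i * (1 / \<kappa> * B * exp (\<kappa> * t)))"
      by (intro sum_mono)
    also have "\<dots> = (\<Sum>i=1..n. C i) / \<kappa> * B * exp (\<kappa> * t)"
      unfolding sum_distrib_right[symmetric] by simp
    finally show "\<bar>V u t\<bar> \<le> (\<Sum>i=1..n. C i) / \<kappa> * B * exp (\<kappa> * t)"
      unfolding V_apply[OF t] memory_part_def sum_divide_distrib
      by (intro order.trans[OF sum_abs])
  qed
qed

section \<open>Successive approximations\<close>

abbreviation "L0_inv \<equiv> op_L0_inv T n \<alpha> K N"

lemma L0_inv_mem: "v \<in> C_space T \<Longrightarrow> L0_inv v \<in> C_space T"
  unfolding op_L0_inv_def by (rule inv_into_into) (simp add: bij_betw_imp_surj_on[OF L0_bij])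

lemma L0_L0_inv: "v \<in> C_space T \<Longrightarrow> L0 (L0_inv v) = v"
  unfolding op_L0_inv_def by (rule f_inv_into_f[where f = L0 and A = "C_space T"]) (simp add: bij_betw_imp_surj_on[OF L0_bij])

lemma L0_inv_L0: "u \<in> C_space T \<Longrightarrow> L0_inv (L0 u) = u"
  unfolding op_L0_inv_def by (rule inv_into_f_f[OF bij_betw_imp_inj_on[OF L0_bij]])

lemma C_space_diff: "a \<in> C_space T \<Longrightarrow> b \<in> C_space T \<Longrightarrow> (\<lambda>t\<in>{0..T}. a t - b t) \<in> C_space T"
  by (rule C_spaceI) (auto simp: C_space_def intro: continuous_on_diff)

lemma L0_inv_diff:
  assumes "a \<in> C_space T" "b \<in> C_space T" "t \<in> {0..T}"
  shows "L0_inv (\<lambda>t\<in>{0..T}. a t - b t) t = L0_inv a t - L0_inv b t"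
proof -
  let ?u = "\<lambda>t\<in>{0..T}. L0_inv a t - L0_inv b t"
  have u: "?u \<in> C_space T" by (intro C_space_diff L0_inv_mem assms)
  have "L0 ?u = (\<lambda>t\<in>{0..T}. a t - b t)"
  proof (rule C_space_eqI[OF L0_maps[OF u] C_space_diff[OF assms(1,2)]])
    fix s assume s: "s \<in> {0..T}"
    then have "L0 ?u s = L0 (L0_inv a) s - L0 (L0_inv b) s" by (rule L0_diff) simp
    then show "L0 ?u s = (\<lambda>t\<in>{0..T}. a t - b t) s" using s by (simp add: L0_L0_inv assms)
  qed
  then have "L0_inv (\<lambda>t\<in>{0..T}. a t - b t) = ?u" using L0_inv_L0[OF u] by simp
  then show ?thesis using assms(3) by simp
qed

lemma L0_inv_bounded: "\<exists>M. \<forall>v\<in>C_space T. max_norm T (L0_inv v) \<le> M * max_norm T v"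
proof -
  obtain c where c: "0 < c"
    "\<And>u B \<kappa> t. \<lbrakk>u \<in> C_space T; 0 \<le> \<kappa>; \<And>s. s \<in> {0..T} \<Longrightarrow> \<bar>L0 u s\<bar> \<le> B * exp (\<kappa> * s); t \<in> {0..T}\<rbrakk>
      \<Longrightarrow> \<bar>u t\<bar> \<le> c * B * exp (\<kappa> * t)"
    using L0_coercive by blast
  have "max_norm T (L0_inv v) \<le> c * max_norm T v" if v: "v \<in> C_space T" for v
  proof (rule max_norm_least)
    fix t assume t: "t \<in> {0..T}"
    have "\<bar>L0 (L0_inv v) s\<bar> \<le> max_norm T v * exp (0 * s)" if "s \<in> {0..T}" for s
      using max_norm_upper[OF v that] by (simp add: L0_L0_inv[OF v])
    from c(2)[OF L0_inv_mem[OF v] order.refl this t] show "\<bar>L0_inv v t\<bar> \<le> c * max_norm T v" by simp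
  qed (use T_pos in simp)
  then show ?thesis by blast
qed

text \<open>The equation \<open>L\<^sub>0 u + V u = h\<close> says that \<open>u\<close> is a fixed point of \<open>u \<mapsto> A u + L\<^sub>0\<^sup>-\<^sup>1 h\<close>, where
  \<open>A = - L\<^sub>0\<^sup>-\<^sup>1 V\<close>. In the norm with weight \<open>exp (- \<kappa> t)\<close> the inverse of \<open>L\<^sub>0\<close> is bounded by a constant \<open>c\<close>
  independent of \<open>\<kappa>\<close> and \<open>V\<close> by \<open>M / \<kappa>\<close>, so the map is a contraction as soon as \<open>\<kappa> > c M\<close>.\<close>
lemma successive_approximations:
  assumes h: "h \<in> C_space T"
  obtains u where "u \<in> C_space T" "\<And>t. t \<in> {0..T} \<Longrightarrow> L0 u t + V u t = h t"
    "\<And>w. w \<in> C_space T \<Longrightarrow> (\<And>t. t \<in> {0..T} \<Longrightarrow> L0 w t + V w t = h t) \<Longrightarrow> w = u"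
    "\<And>us. us 0 \<in> C_space T \<Longrightarrow>
      (\<And>m. us (Suc m) = (\<lambda>t\<in>{0..T}. op_A T n \<alpha> K K' N (us m) t + L0_inv h t)) \<Longrightarrow>
      (\<forall>m. us m \<in> C_space T) \<and> (\<lambda>m. max_norm T (\<lambda>t. us m t - u t)) \<longlonglongrightarrow> 0"
proof -
  obtain c where c: "0 < c"
    "\<And>u B \<kappa> t. \<lbrakk>u \<in> C_space T; 0 \<le> \<kappa>; \<And>s. s \<in> {0..T} \<Longrightarrow> \<bar>L0 u s\<bar> \<le> B * exp (\<kappa> * s); t \<in> {0..T}\<rbrakk>
      \<Longrightarrow> \<bar>u t\<bar> \<le> c * B * exp (\<kappa> * t)"
    using L0_coercive by blast
  obtain M where M: "0 \<le> M"
    "\<And>u B \<kappa> t. \<lbrakk>u \<in> C_space T; 0 < \<kappa>; \<And>s. s \<in> {0..T} \<Longrightarrow> \<bar>u s\<bar> \<le> B * exp (\<kappa> * s); t \<in> {0..T}\<rbrakk>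
      \<Longrightarrow> \<bar>V u t\<bar> \<le> M / \<kappa> * B * exp (\<kappa> * t)"
    using V_bound by blast
  define \<kappa> where "\<kappa> = c * M + 1"
  have \<kappa>: "\<kappa> > 0" using c M by (simp add: \<kappa>_def add_nonneg_pos)
  define \<theta> where "\<theta> = c * M / \<kappa>"
  have \<theta>: "0 \<le> \<theta>" "\<theta> < 1" using c M \<kappa> by (simp_all add: \<theta>_def \<kappa>_def)
  let ?\<Phi> = "\<lambda>u. \<lambda>t\<in>{0..T}. op_A T n \<alpha> K K' N u t + L0_inv h t"
  have \<Phi>: "?\<Phi> u = L0_inv (\<lambda>t\<in>{0..T}. h t - V u t)" if u: "u \<in> C_space T" for u
  proof
    show "?\<Phi> u t = L0_inv (\<lambda>t\<in>{0..T}. h t - V u t) t" for t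
    proof (cases "t \<in> {0..T}")
      case True
      then show ?thesis
        using L0_inv_diff[OF h V_maps[OF u] True] by (simp add: op_A_def)
    next
      case False
      have "L0_inv (\<lambda>t\<in>{0..T}. h t - V u t) \<in> extensional {0..T}"
        using L0_inv_mem[OF C_space_diff[OF h V_maps[OF u]]] by (simp add: C_space_def)
      from extensional_arb[OF this False] show ?thesis using False by (simp only: restrict_apply if_False)
    qed
  qed
  have maps: "?\<Phi> u \<in> C_space T" if "u \<in> C_space T" for u
    unfolding \<Phi>[OF that] by (intro L0_inv_mem C_space_diff h V_maps that)
  have fp: "?\<Phi> u = u \<longleftrightarrow> (\<forall>t\<in>{0..T}. L0 u t + V u t = h t)" if u: "u \<in> C_space T" for u
  proof -
    let ?r = "\<lambda>t\<in>{0..T}. h t - V u t"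
    have r: "?r \<in> C_space T" by (intro C_space_diff h V_maps u)
    have "?\<Phi> u = u \<longleftrightarrow> L0 u = ?r"
      unfolding \<Phi>[OF u] using L0_L0_inv[OF r] L0_inv_L0[OF u] by metis
    also have "\<dots> \<longleftrightarrow> (\<forall>t\<in>{0..T}. L0 u t = h t - V u t)"
    proof
      show "L0 u = ?r" if "\<forall>t\<in>{0..T}. L0 u t = h t - V u t"
        by (rule C_space_eqI[OF L0_maps[OF u] r]) (use that in simp)
      show "\<forall>t\<in>{0..T}. L0 u t = h t - V u t" if "L0 u = ?r"
        unfolding that by simp
    qed
    finally show ?thesis by (simp add: eq_diff_eq)
  qed
  have contr: "\<bar>?\<Phi> a t - ?\<Phi> b t\<bar> \<le> \<theta> * B * exp (\<kappa> * t)"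
    if a: "a \<in> C_space T" and b: "b \<in> C_space T"
      and ab: "\<And>t. t \<in> {0..T} \<Longrightarrow> \<bar>a t - b t\<bar> \<le> B * exp (\<kappa> * t)" and t: "t \<in> {0..T}" for a b B t
  proof -
    let ?d = "\<lambda>t\<in>{0..T}. a t - b t"
    let ?w = "\<lambda>t\<in>{0..T}. ?\<Phi> a t - ?\<Phi> b t"
    have d: "?d \<in> C_space T" by (intro C_space_diff a b)
    have w: "?w \<in> C_space T" by (intro C_space_diff maps a b)
    have "\<bar>L0 ?w s\<bar> \<le> M / \<kappa> * B * exp (\<kappa> * s)" if s: "s \<in> {0..T}" for s
    proof -
      have L\<Phi>: "L0 (?\<Phi> u) s = h s - V u s" if "u \<in> C_space T" for u
        unfolding \<Phi>[OF that] L0_L0_inv[OF C_space_diff[OF h V_maps[OF that]]] using s by simp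
      have "L0 ?w s = L0 (?\<Phi> a) s - L0 (?\<Phi> b) s" by (rule L0_diff[OF s]) simp
      also have "\<dots> = - (V a s - V b s)" unfolding L\<Phi>[OF a] L\<Phi>[OF b] by simp
      also have "V a s - V b s = V ?d s" by (rule V_diff[OF s _ a b, symmetric]) simp
      finally have "\<bar>L0 ?w s\<bar> = \<bar>V ?d s\<bar>" by (simp only: abs_minus_cancel)
      also have "\<dots> \<le> M / \<kappa> * B * exp (\<kappa> * s)"
        by (rule M(2)[OF d \<kappa> _ s]) (use ab in simp)
      finally show ?thesis .
    qed
    from c(2)[OF w less_imp_le[OF \<kappa>] this t]
    have "\<bar>?w t\<bar> \<le> c * (M / \<kappa> * B) * exp (\<kappa> * t)" .
    then show ?thesis using t by (simp add: \<theta>_def)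
  qed
  show thesis
  proof (rule C_space_fixed_point[of T \<kappa> \<theta> ?\<Phi>])
    fix u assume u: "u \<in> C_space T" "?\<Phi> u = u"
      and uniq: "\<And>w. w \<in> C_space T \<Longrightarrow> ?\<Phi> w = w \<Longrightarrow> w = u"
      and orbit: "\<And>us. us 0 \<in> C_space T \<Longrightarrow> (\<And>m. us (Suc m) = ?\<Phi> (us m)) \<Longrightarrow>
        (\<forall>m. us m \<in> C_space T) \<and> (\<lambda>m. max_norm T (\<lambda>t. us m t - u t)) \<longlonglongrightarrow> 0"
    show thesis
    proof (rule that[OF u(1)])
      show "L0 u t + V u t = h t" if "t \<in> {0..T}" for t
        using fp[OF u(1)] u(2) that by simp
      show "w = u" if "w \<in> C_space T" "\<And>t. t \<in> {0..T} \<Longrightarrow> L0 w t + V w t = h t" for w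
        by (rule uniq[OF that(1) fp[OF that(1), THEN iffD2]]) (use that(2) in blast)
    qed (rule orbit)
  next
    fix a b B t
    assume "a \<in> C_space T" "b \<in> C_space T"
      and "\<And>t. t \<in> {0..T} \<Longrightarrow> \<bar>a t - b t\<bar> \<le> B * exp (\<kappa> * t)" and "t \<in> {0..T}"
    from contr[OF this] show "\<bar>?\<Phi> a t - ?\<Phi> b t\<bar> \<le> \<theta> * B * exp (\<kappa> * t)" .
  next
    fix u assume "u \<in> C_space T"
    then show "?\<Phi> u \<in> C_space T" by (rule maps)
  qed (use T_pos \<kappa> \<theta> in linarith)+
qed

end

section \<open>Reduction to the functional equation\<close>

locale volterra_problem = dominant_kernel +
  fixes f f' :: "real \<Rightarrow> real"
  assumes f_deriv: "\<And>t. t \<in> {0..T} \<Longrightarrow> (f has_real_derivative f' t) (at t within {0..T})"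
    and f'_cont: "continuous_on {0..T} f'" and f_0: "f 0 = 0"
    and cond_B: "condition_B T n K f N" and L_nz: "\<And>j. char_L n \<alpha> K j \<noteq> 0"
begin

abbreviation "undet \<equiv> undetermined_coefficients T n \<alpha> K f N"
abbreviation "res x \<equiv> residual n \<alpha> K f (x_poly N x)"
abbreviation "h \<equiv> rhs_h T n \<alpha> K f N"

text \<open>The derivative of the residual of \<open>x\<^sup>N\<close>.\<close>
definition res' :: "(nat \<Rightarrow> real) \<Rightarrow> real \<Rightarrow> real" where
  "res' x t = f' t - (\<Sum>m\<le>N. x m * (t ^ m * monomial_factor m t))"

lemma res'_cont: "continuous_on {0..T} (res' x)"
  unfolding res'_def by (intro continuous_intros f'_cont monomial_factor_cont)

lemma x_poly_cont: "continuous_on {0..T} (x_poly N x)"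
  unfolding x_poly_def by (intro continuous_intros)

lemma kernel_integrable:
  "t \<in> {0..T} \<Longrightarrow> continuous_on {0..T} y \<Longrightarrow> (\<lambda>s. kernel n \<alpha> K t s * y s) integrable_on {0..t}"
  using kernel_has_integral by blast

lemma residual_deriv:
  assumes t: "t \<in> {0..T}"
  shows "(res x has_real_derivative res' x t) (at t within {0..T})"
proof -
  let ?I = "\<lambda>m t. integral {0..t} (\<lambda>s. kernel n \<alpha> K t s * (s ^ m * 1))"
  have eq: "f \<tau> - (\<Sum>m\<le>N. x m * ?I m \<tau>) = res x \<tau>" if \<tau>: "\<tau> \<in> {0..T}" for \<tau>
  proof -
    have int: "(\<lambda>s. x m * (kernel n \<alpha> K \<tau> s * (s ^ m * 1))) integrable_on {0..\<tau>}" for m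
      by (intro integrable_on_mult_right kernel_integrable \<tau> continuous_intros)
    have "(\<lambda>s. kernel n \<alpha> K \<tau> s * x_poly N x s) = (\<lambda>s. \<Sum>m\<le>N. x m * (kernel n \<alpha> K \<tau> s * (s ^ m * 1)))"
      by (simp add: x_poly_def sum_distrib_left mult_ac)
    then have "integral {0..\<tau>} (\<lambda>s. kernel n \<alpha> K \<tau> s * x_poly N x s) = (\<Sum>m\<le>N. x m * ?I m \<tau>)"
      using integral_sum[OF finite_atMost int] by simp
    then show ?thesis by (simp add: residual_def)
  qed
  have "((\<lambda>\<tau>. f \<tau> - (\<Sum>m\<le>N. x m * ?I m \<tau>)) has_real_derivative res' x t) (at t within {0..T})"
    unfolding res'_def monomial_factor_def
    by (intro DERIV_diff f_deriv t DERIV_sum DERIV_cmult kernel_integral_deriv continuous_on_const)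
  from has_field_derivative_transform_within[OF this zero_less_one t eq] show ?thesis .
qed

lemma deriv_on_residual: "t \<in> {0..T} \<Longrightarrow> deriv_on T (res x) t = res' x t"
  unfolding deriv_on_def using T_pos residual_deriv
  by (intro vector_derivative_within_closed_interval) (simp_all add: has_real_derivative_iff_has_vector_derivative)

lemma undetermined_iff: "undet x \<longleftrightarrow> res' x \<in> o[at_right 0](\<lambda>t. t ^ N)"
proof -
  have "\<forall>\<^sub>F t in at_right 0. deriv_on T (res x) t = res' x t"
    unfolding eventually_at_right_field using T_pos deriv_on_residual by (intro exI[of _ T]) auto
  then have "deriv_on T (res x) \<in> o[at_right 0](\<lambda>t. t ^ N) \<longleftrightarrow> res' x \<in> o[at_right 0](\<lambda>t. t ^ N)"
    by (rule landau_o.small.in_cong)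
  moreover have "\<forall>t\<in>{0<..T}. res x differentiable (at t within {0..T})"
  proof
    fix t assume "t \<in> {0<..T}"
    then have "t \<in> {0..T}" by simp
    from residual_deriv[OF this] show "res x differentiable (at t within {0..T})"
      unfolding real_differentiable_def by blast
  qed
  ultimately show ?thesis by (simp add: undetermined_coefficients_def)
qed

text \<open>The requirement on \<open>x\<^sup>N\<close> is a triangular system: its diagonal entry for \<open>x\<^sub>m\<close> is \<open>L(m)\<close>, the
  value at 0 of \<open>monomial_factor m\<close>.\<close>
lemma undetermined_exists: "\<exists>x. undet x"
proof -
  obtain U where U: "open U" "0 \<in> U" and "times_differentiable_on (N + 1) f (U \<inter> {0..T})"
    using cond_B unfolding condition_B_def by blast
  then have "times_differentiable_on (Suc N) f (U \<inter> {0..T})" by (simp only: Suc_eq_plus1)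
  from taylor_approx_deriv[OF T_pos U this f_deriv f'_cont] have "taylor_approx N f'" by simp
  from triangular_coefficients_exist[OF monomial_factor_lim L_nz monomial_factor_taylor[OF cond_B] this]
  show ?thesis unfolding undetermined_iff res'_def .
qed

lemma undetermined_unique:
  assumes "undet x" "undet y" "i \<le> N"
  shows "y i = x i"
proof -
  have "(\<lambda>t. res' x t - res' y t) \<in> o[at_right 0](\<lambda>t. t ^ N)"
    using assms unfolding undetermined_iff by (intro sum_in_smallo)
  moreover have "(\<lambda>t. res' x t - res' y t) = (\<lambda>t. \<Sum>m\<le>N. (y m - x m) * (t ^ m * monomial_factor m t))"
    by (simp add: res'_def left_diff_distrib sum_subtractf)
  ultimately have "(\<lambda>t. \<Sum>m\<le>N. (y m - x m) * (t ^ m * monomial_factor m t)) \<in> o[at_right 0](\<lambda>t. t ^ N)"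
    by simp
  from triangular_coefficients_unique[OF monomial_factor_lim L_nz this assms(3)] show ?thesis by simp
qed

lemma h_0: "h x 0 = 0"
  using T_pos by (simp add: rhs_h_def)

lemma h_pos: "t \<in> {0<..T} \<Longrightarrow> t ^ N * K n t t * h x t = res' x t"
  using diag_nz[of t] by (simp add: rhs_h_def deriv_on_residual)

text \<open>The choice of the coefficients enters here: it is exactly what makes \<open>h\<close> continuous at 0.\<close>
lemma h_mem:
  assumes "undet x"
  shows "h x \<in> C_space T"
proof -
  define k where "k t = res' x t / t ^ N * inverse (K n t t)" for t
  have hk: "h x t = k t" if "t \<in> {0<..T}" for t
    using that by (simp add: k_def rhs_h_def deriv_on_residual field_simps)
  have "continuous (at t within {0..T}) (h x)" if t: "t \<in> {0..T}" for t
  proof (cases "t = 0")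
    case True
    have "((\<lambda>t. inverse (K n t t)) \<longlongrightarrow> inverse (K n 0 0)) (at 0 within {0..T})"
      using diag_cont T_pos diag_nz[of 0] by (intro tendsto_inverse) (simp_all add: continuous_on_def)
    then have lim1: "((\<lambda>t. inverse (K n t t)) \<longlongrightarrow> inverse (K n 0 0)) (at_right 0)"
      using T_pos by (simp add: at_within_Icc_at_right)
    have lim2: "((\<lambda>t. res' x t / t ^ N) \<longlongrightarrow> 0) (at_right 0)"
      using assms unfolding undetermined_iff by (rule smalloD_tendsto)
    have "(k \<longlongrightarrow> 0) (at_right 0)"
      unfolding k_def using tendsto_mult[OF lim2 lim1] by simp
    moreover have "\<forall>\<^sub>F t in at_right 0. k t = h x t"
      unfolding eventually_at_right_field using T_pos hk by (intro exI[of _ T]) auto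
    ultimately have "(h x \<longlongrightarrow> 0) (at_right 0)" by (rule Lim_transform_eventually)
    then show ?thesis
      using T_pos True by (simp add: continuous_within at_within_Icc_at_right h_0)
  next
    case False
    then have t': "t \<in> {0<..T}" using t by simp
    have "continuous_on {0<..T} k"
      unfolding k_def
      by (intro continuous_intros continuous_on_subset[OF res'_cont] continuous_on_subset[OF diag_cont])
         (auto simp: diag_nz)
    then have "continuous (at t within {0<..T}) k"
      using t' unfolding continuous_on_eq_continuous_within by blast
    then have "continuous (at t within {0<..T}) (h x)"
      by (rule continuous_transform_within[OF _ zero_less_one t']) (simp add: hk)
    moreover have "at t within {0..T} = at t within {0<..T}"
      using t' by (intro at_within_nhd[of _ "{0<..}"]) auto
    ultimately show ?thesis by simp
  qed
  then show ?thesis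
    by (simp add: C_space_def continuous_on_eq_continuous_within rhs_h_def)
qed

text \<open>Both sides of the reduced equation vanish at \<open>t = 0\<close>, so it is equivalent to the equation of the
  derivatives, and these are \<open>t\<^sup>N K\<^sub>n(t,t) (L\<^sub>0 w + V w)\<close> and \<open>t\<^sup>N K\<^sub>n(t,t) h\<close>. The factor \<open>t\<^sup>N\<close> can be
  cancelled only for \<open>t > 0\<close>; equality at 0 follows by continuity.\<close>
lemma reduced_iff:
  assumes x: "undet x" and w: "w \<in> C_space T"
  shows "solves_reduced_equation T n \<alpha> K f N x w \<longleftrightarrow> (\<forall>t\<in>{0..T}. L0 w t + V w t = h x t)"
proof -
  let ?F = "\<lambda>t. integral {0..t} (\<lambda>s. kernel n \<alpha> K t s * (s ^ N * w s))"
  let ?D = "\<lambda>t. t ^ N * (boundary_part N w t + memory_part N w t)"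
  have wc: "continuous_on {0..T} w" using w by (simp add: C_space_def)
  have F_deriv: "(?F has_real_derivative ?D t) (at t within {0..T})" if "t \<in> {0..T}" for t
    using kernel_integral_deriv[OF that wc] .
  have D_eq: "?D t = t ^ N * K n t t * (L0 w t + V w t)" if "t \<in> {0..T}" for t
    using diag_nz[OF that] by (simp add: L0_apply[OF that] V_apply[OF that] field_simps)
  have solves: "solves_reduced_equation T n \<alpha> K f N x w \<longleftrightarrow> (\<forall>t\<in>{0..T}. ?F t = res x t)"
    unfolding solves_reduced_equation_def
    using kernel_integrable[OF _ continuous_on_mult[OF continuous_on_power[OF continuous_on_id] wc]]
    by (auto simp: has_integral_iff)
  have cont: "continuous_on {0..T} (\<lambda>t. L0 w t + V w t - h x t)"
    using L0_maps[OF w] V_maps[OF w] h_mem[OF x]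
    by (intro continuous_on_diff continuous_on_add) (simp_all add: C_space_def)
  show ?thesis
    unfolding solves
  proof
    assume eq: "\<forall>t\<in>{0..T}. ?F t = res x t"
    have pos: "L0 w t + V w t - h x t = 0" if t: "t \<in> {0<..T}" for t
    proof -
      have t': "t \<in> {0..T}" using t by simp
      have "(res x has_real_derivative ?D t) (at t within {0..T})"
        by (rule has_field_derivative_transform_within[OF F_deriv[OF t'] zero_less_one t']) (use eq in blast)
      then have 1: "(res x has_vector_derivative ?D t) (at t within {0..T})"
        by (simp only: has_real_derivative_iff_has_vector_derivative)
      have 2: "(res x has_vector_derivative res' x t) (at t within {0..T})"
        using residual_deriv[OF t'] by (simp only: has_real_derivative_iff_has_vector_derivative)
      have "?D t = res' x t"
        using t' by (intro vector_derivative_unique_within_closed_interval[unfolded cbox_interval, OF T_pos _ 1 2])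
      then have "t ^ N * K n t t * (L0 w t + V w t) = t ^ N * K n t t * h x t"
        unfolding D_eq[OF t'] h_pos[OF t] .
      then show ?thesis using t diag_nz[OF t'] by simp
    qed
    have "L0 w t + V w t - h x t = 0" if "t \<in> {0..T}" for t
    proof (rule continuous_constant_on_closure[where S = "{0<..T}" and x = t
          and f = "\<lambda>t. L0 w t + V w t - h x t" and a = 0])
      show "continuous_on (closure {0<..T}) (\<lambda>t. L0 w t + V w t - h x t)" using cont T_pos by simp
      show "t \<in> closure {0<..T}" using that T_pos by simp
    qed (rule pos)
    then show "\<forall>t\<in>{0..T}. L0 w t + V w t = h x t" by fastforce
  next
    assume eq: "\<forall>t\<in>{0..T}. L0 w t + V w t = h x t"
    have "?D t = res' x t" if t: "t \<in> {0..T}" for t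
    proof -
      have pos: "?D t - res' x t = 0" if "t \<in> {0<..T}" for t
        using that D_eq[of t] h_pos[OF that, of x] eq by simp
      have "?D t - res' x t = 0"
      proof (rule continuous_constant_on_closure[where S = "{0<..T}" and x = t
            and f = "\<lambda>t. ?D t - res' x t" and a = 0])
        have "continuous_on {0..T} (\<lambda>t. ?D t - res' x t)"
          by (intro continuous_on_diff continuous_on_mult continuous_on_add continuous_on_power continuous_on_id
              boundary_part_cont[OF wc] memory_part_cont[OF wc] res'_cont)
        then show "continuous_on (closure {0<..T}) (\<lambda>t. ?D t - res' x t)" using T_pos by simp
        show "t \<in> closure {0<..T}" using t T_pos by simp
      qed (rule pos)
      then show ?thesis by simp
    qed
    then have "((\<lambda>t. ?F t - res x t) has_real_derivative 0) (at t within {0..T})" if "t \<in> {0..T}" for t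
      using DERIV_diff[OF F_deriv[OF that] residual_deriv[OF that, of x]] that by simp
    then obtain c where c: "\<And>t. t \<in> {0..T} \<Longrightarrow> ?F t - res x t = c"
      using has_field_derivative_zero_constant[of "{0..T}" "\<lambda>t. ?F t - res x t"] by auto
    have "c = 0" using c[of 0] T_pos by (simp add: residual_def f_0)
    then show "\<forall>t\<in>{0..T}. ?F t = res x t" using c by simp
  qed
qed

lemma solution_from_reduced:
  assumes u: "u \<in> C_space T" and red: "solves_reduced_equation T n \<alpha> K f N x u"
  shows "continuous_on {0..T} (\<lambda>t. (\<Sum>i\<le>N. x i * t ^ i) + t ^ N * u t)"
    and "solves_equation T n \<alpha> K f (\<lambda>t. (\<Sum>i\<le>N. x i * t ^ i) + t ^ N * u t)"
proof -
  show "continuous_on {0..T} (\<lambda>t. (\<Sum>i\<le>N. x i * t ^ i) + t ^ N * u t)"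
    using u by (intro continuous_intros) (simp add: C_space_def)
  show "solves_equation T n \<alpha> K f (\<lambda>t. (\<Sum>i\<le>N. x i * t ^ i) + t ^ N * u t)"
    unfolding solves_equation_def
  proof
    fix t assume "t \<in> {0<..T}"
    then have t: "t \<in> {0..T}" by simp
    have "((\<lambda>s. kernel n \<alpha> K t s * x_poly N x s + kernel n \<alpha> K t s * (s ^ N * u s)) has_integral
        integral {0..t} (\<lambda>s. kernel n \<alpha> K t s * x_poly N x s) + res x t) {0..t}"
      using red t unfolding solves_reduced_equation_def
      by (intro has_integral_add integrable_integral kernel_integrable x_poly_cont) auto
    then show "((\<lambda>s. kernel n \<alpha> K t s * ((\<Sum>i\<le>N. x i * s ^ i) + s ^ N * u s)) has_integral f t) {0..t}"
      by (simp add: residual_def distrib_left x_poly_def)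
  qed
qed

end

section \<open>Solution of the integral equation\<close>

theorem theorem2p1:
  fixes T :: real and n N :: nat and \<alpha> :: "nat \<Rightarrow> real"
    and K K' :: "nat \<Rightarrow> real \<Rightarrow> real \<Rightarrow> real" and f f' :: "real \<Rightarrow> real"
  assumes "T > 0" and "n \<ge> 1"
    and "\<alpha> 0 = 0" and "\<alpha> n = 1" and "strict_mono_on {0..n} \<alpha>"
    and "\<And>i. i \<in> {1..n} \<Longrightarrow> continuous_on (kernel_domain T) (\<lambda>(t, s). K i t s)"
    and "\<And>i t s. i \<in> {1..n} \<Longrightarrow> (t, s) \<in> kernel_domain T \<Longrightarrow>
           ((\<lambda>\<tau>. K i \<tau> s) has_real_derivative K' i t s) (at t within {s..T})"
    and "\<And>i. i \<in> {1..n} \<Longrightarrow> continuous_on (kernel_domain T) (\<lambda>(t, s). K' i t s)"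
    and "\<And>t. t \<in> {0..T} \<Longrightarrow> (f has_real_derivative f' t) (at t within {0..T})"
    and "continuous_on {0..T} f'"
    and "f 0 = 0"
    and "condition_A T n \<alpha> K N"
    and "condition_B T n K f N"
    and "\<And>j. char_L n \<alpha> K j \<noteq> 0"
  shows "\<exists>x.
    undetermined_coefficients T n \<alpha> K f N x \<and>
    (\<forall>y. undetermined_coefficients T n \<alpha> K f N y \<longrightarrow> (\<forall>i\<le>N. y i = x i)) \<and>
    (\<exists>u\<in>C_space T.
      solves_reduced_equation T n \<alpha> K f N x u \<and>
      (\<forall>w\<in>C_space T. solves_reduced_equation T n \<alpha> K f N x w \<longrightarrow> w = u) \<and>
      continuous_on {0..T} (\<lambda>t. (\<Sum>i\<le>N. x i * t ^ i) + t ^ N * u t) \<and>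
      solves_equation T n \<alpha> K f (\<lambda>t. (\<Sum>i\<le>N. x i * t ^ i) + t ^ N * u t) \<and>
      bij_betw (op_L0 T n \<alpha> K N) (C_space T) (C_space T) \<and>
      (\<exists>M. \<forall>v\<in>C_space T. max_norm T (op_L0_inv T n \<alpha> K N v) \<le> M * max_norm T v) \<and>
      (\<forall>us. us 0 \<in> C_space T \<longrightarrow>
        (\<forall>m. us (Suc m) = (\<lambda>t\<in>{0..T}. op_A T n \<alpha> K K' N (us m) t
                + op_L0_inv T n \<alpha> K N (rhs_h T n \<alpha> K f N x) t)) \<longrightarrow>
        (\<forall>m. us m \<in> C_space T) \<and>
        (\<lambda>m. max_norm T (\<lambda>t. us m t - u t)) \<longlonglongrightarrow> 0))"
proof -
  interpret volterra_problem T n \<alpha> K K' N f f'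
    using assms by unfold_locales
  obtain x where x: "undet x" using undetermined_exists by blast
  show ?thesis
  proof (rule successive_approximations[OF h_mem[OF x]])
    fix u assume u: "u \<in> C_space T" and sol: "\<And>t. t \<in> {0..T} \<Longrightarrow> L0 u t + V u t = h x t"
      and uniq: "\<And>w. w \<in> C_space T \<Longrightarrow> (\<And>t. t \<in> {0..T} \<Longrightarrow> L0 w t + V w t = h x t) \<Longrightarrow> w = u"
      and conv: "\<And>us. us 0 \<in> C_space T \<Longrightarrow>
        (\<And>m. us (Suc m) = (\<lambda>t\<in>{0..T}. op_A T n \<alpha> K K' N (us m) t + L0_inv (h x) t)) \<Longrightarrow>
        (\<forall>m. us m \<in> C_space T) \<and> (\<lambda>m. max_norm T (\<lambda>t. us m t - u t)) \<longlonglongrightarrow> 0"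
    have red: "solves_reduced_equation T n \<alpha> K f N x u"
      unfolding reduced_iff[OF x u] using sol by (rule ballI)
    have uniq': "w = u" if "w \<in> C_space T" "solves_reduced_equation T n \<alpha> K f N x w" for w
      by (rule uniq[OF that(1)]) (use that(2) reduced_iff[OF x that(1)] in blast)
    show ?thesis
      by (intro exI[of _ x] bexI[OF _ u] conjI x red solution_from_reduced[OF u red] L0_bij L0_inv_bounded
          allI ballI impI undetermined_unique[OF x] uniq') (use conv in auto)
  qed
qed

end
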